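(* Let $q$ be a positive integer, $\psi$ a primitive Dirichlet character modulo $q$, $\ell$ a positive integer, $h$ an integer with $(h,\ell q)=1$, and $\xi \in \mathbb{C}$. Let $\overline{h}$ denote an integer with $h\overline{h} \equiv 1 \pmod{\ell q}$. Then, as meromorphic functions of $s \in \mathbb{C}$, \begin{multline*} D_{\psi}(s, \xi; h/\ell q) = \psi(-\overline{h})(2\pi)^{2s-\xi-2}(\ell q)^{\xi-2s+1} \Gamma(1-s) \Gamma(1+\xi-s)\\ \times \Big[\big\{e(\xi/4)+\psi(-1) e(-\xi/4) \big\} D_{\psi}(1+\xi-s, \xi; \overline{h}/\ell q) - \big\{e((2s-\xi)/4)+\psi(-1) e(-(2s-\xi)/4) \big\} D_{\psi}(1+\xi-s, \xi; -\overline{h}/\ell q) \Big]. \end{multline*}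
   Context: Write $e(z)=\exp(2\pi i z)$. For $n \in \mathbb{N}$ define the twisted divisor function $\sigma_{\xi}(n,\psi)=\sum_{d\mid n}\psi(d)d^{\xi}$. For integers $h$ coprime to $\ell q$, the twisted Estermann zeta function is \begin{equation*} D_{\psi}(s,\xi;h/\ell q)=\sum_{n=1}^{\infty}\sigma_{\xi}(n,\psi)\, e\!\left(\frac{hn}{\ell q}\right) n^{-s}, \end{equation*} defined by this absolutely convergent series for $\Re(s)$ sufficiently large and extended meromorphically to all $s\in\mathbb{C}$ (it depends on $h$ only modulo $\ell q$, so $D_\psi(\cdot,\xi;\pm\overline{h}/\ell q)$ is well defined). *)

theory Defs
  imports "HOL-Complex_Analysis.Complex_Analysis" "HOL-Number_Theory.Number_Theory"
begin

definition e_fun :: "complex \<Rightarrow> complex" where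
  "e_fun z = exp (2 * of_real pi * \<i> * z)"

definition dirichlet_char :: "nat \<Rightarrow> (int \<Rightarrow> complex) \<Rightarrow> bool" where
  "dirichlet_char q c \<longleftrightarrow> q > 0 \<and>
     (\<forall>a b. c (a * b) = c a * c b) \<and>
     (\<forall>a. c (a + int q) = c a) \<and>
     c 1 = 1 \<and>
     (\<forall>a. \<not> coprime a (int q) \<longrightarrow> c a = 0)"

definition primitive_dirichlet_char :: "nat \<Rightarrow> (int \<Rightarrow> complex) \<Rightarrow> bool" where
  "primitive_dirichlet_char q c \<longleftrightarrow> dirichlet_char q c \<and>
     (\<forall>d. d dvd q \<and> d < q \<longrightarrow>
        (\<exists>a. coprime a (int q) \<and> [a = 1] (mod int d) \<and> c a \<noteq> 1))"

definition sigma_tw :: "(int \<Rightarrow> complex) \<Rightarrow> complex \<Rightarrow> nat \<Rightarrow> complex" where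
  "sigma_tw \<psi> \<xi> n = (\<Sum>d\<in>{d. d dvd n}. \<psi> (int d) * (of_nat d) powr \<xi>)"

text \<open>The Dirichlet series defining D_psi(s, xi; h/m) (m = l q), for Re s large.\<close>
definition estermann_series :: "(int \<Rightarrow> complex) \<Rightarrow> complex \<Rightarrow> int \<Rightarrow> nat \<Rightarrow> complex \<Rightarrow> complex" where
  "estermann_series \<psi> \<xi> h m s =
     (\<Sum>n. sigma_tw \<psi> \<xi> (Suc n) * e_fun (of_int h * of_nat (Suc n) / of_nat m)
            * (of_nat (Suc n)) powr (-s))"

definition is_estermann_cont ::
  "(int \<Rightarrow> complex) \<Rightarrow> complex \<Rightarrow> int \<Rightarrow> nat \<Rightarrow> (complex \<Rightarrow> complex) \<Rightarrow> bool" where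
  "is_estermann_cont \<psi> \<xi> h m D \<longleftrightarrow> D meromorphic_on UNIV \<and>
     (\<exists>\<sigma>::real. \<forall>s. \<sigma> < Re s \<longrightarrow> D s = estermann_series \<psi> \<xi> h m s)"

end

theory Submission
  imports Defs
begin

text \<open>
  Write \<open>k = l q\<close>. Sorting the pairs \<open>(d, m)\<close> with \<open>n = d m\<close> by the residue class \<open>a\<close> of \<open>d\<close>
  modulo \<open>k\<close> gives
  \<open>D(s, \<xi>; h/k) = (\<Sum>a<k. \<psi>(a) L\<^sub>a(s - \<xi>) F\<^bsub>ha\<^esub>(s))\<close>, where \<open>F\<^sub>c(s) = (\<Sum>n. e(cn/k) n\<^bsup>-s\<^esup>)\<close> and \<open>L\<^sub>a\<close> is
  the Dirichlet series over the residue class \<open>a\<close>. The functional equation of \<open>F\<^sub>c\<close> relates it to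
  \<open>L\<^sub>c(1 - s)\<close> and \<open>L\<^bsub>-c\<^esub>(1 - s)\<close>, and finite Fourier inversion gives the one for \<open>L\<^sub>a\<close>. Multiplying
  the two and substituting \<open>a = \<plusminus>hb b\<close> in the finite sum yields the four terms of the theorem.

  For \<open>F\<^sub>c\<close> itself, \<open>\<Gamma>(s) F\<^sub>c(s)\<close> is the Mellin transform of \<open>g(x) = \<omega>e\<^bsup>-x\<^esup>/(1 - \<omega>e\<^bsup>-x\<^esup>)\<close> with
  \<open>\<omega> = e(c/k)\<close>. By the reflection formula \<open>\<pi> cot \<pi>z = Digamma(1 - z) - Digamma z\<close>, \<open>g\<close> equals
  \<open>A/x + B\<close> plus a difference of two increments of the Digamma function along vertical lines. Removing
  \<open>A/x + B\<close> on \<open>(0, 1)\<close> continues the transform to \<open>Re s > -1\<close>; for \<open>-1 < Re s < 0\<close> it is the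
  transform of the Digamma part, which can be integrated term by term.
\<close>

section \<open>Mellin transforms\<close>

text \<open>The two series in the functional equation of \<open>F\<^sub>c\<close> converge for Re s
  > 1 and for Re s < 0, so they never meet. The strip -1 < Re s < 0 is the bridge. There the Digamma
  part can be integrated against x powr (s - 1), being O(x) at 0 and of logarithmic growth at
  infinity, and there the dual series converges as well. Further left the dual expression itself
  serves as the continuation, so one subtraction at 0 is enough, and the functional equation spreads
  from Re s < 0 by the identity theorem on the connected set C minus the integers. A continuation D
  is known only through its series on some half-plane and may take any value at a pole. It is
  therefore determined only off a sparse set. For this reason an explicit finite sum is constructed,
  the theorem is proved for it at every s with s and s - \<xi> not integers, and D1, D2, D3 are
  compared with it off sparse sets.\<close>

definition mellin_conv :: "real set \<Rightarrow> (real \<Rightarrow> complex) \<Rightarrow> complex \<Rightarrow> bool" where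
  "mellin_conv S f s \<longleftrightarrow> set_integrable lborel S (\<lambda>x. of_real x powr (s - 1) * f x)"

text \<open>The set is a parameter because the transform is later cut at 1 and exhausted by compact
  intervals.\<close>

definition mellin :: "real set \<Rightarrow> (real \<Rightarrow> complex) \<Rightarrow> complex \<Rightarrow> complex" where
  "mellin S f s = (LINT x:S|lborel. of_real x powr (s - 1) * f x)"

lemma powr_of_real_mult:
  assumes "c > 0" "x > 0"
  shows "complex_of_real (c * x) powr w = of_real c powr w * of_real x powr w"
  using assms by (simp add: powr_times_real)

lemma of_real_inverse_powr:
  assumes "c > 0"
  shows "complex_of_real (1 / c) powr w = of_real c powr (-w)"
proof -
  have "complex_of_real (1 / c) powr w * of_real c powr w = 1"
    using powr_of_real_mult[of "1 / c" c w] assms by simp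
  thus ?thesis using assms by (simp add: powr_minus field_simps)
qed

text \<open>The indicator stays inside the identity so that it holds for every real x, as the affine
  change of variables over the whole line requires.\<close>

lemma mellin_scale_indicator:
  assumes "c > 0"
  shows "indicator {0<..} (c * x) *\<^sub>R (complex_of_real (c * x) powr (s - 1) * f (c * x)) =
     of_real c powr (s - 1) * (indicator {0<..} x *\<^sub>R (complex_of_real x powr (s - 1) * f (c * x)))"
proof (cases "x > 0")
  case True
  thus ?thesis using assms by (simp add: powr_times_real indicator_def)
next
  case False
  hence "\<not> c * x > 0" using assms by (simp add: zero_less_mult_iff)
  thus ?thesis using False by simp
qed

lemma mellin_conv_scale:
  assumes "c > 0" "mellin_conv {0<..} f s"
  shows "mellin_conv {0<..} (\<lambda>x. f (c * x)) s"
proof -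
  define h where "h = (\<lambda>x. indicator {0<..} x *\<^sub>R (complex_of_real x powr (s - 1) * f (c * x)))"
  have "integrable lborel (\<lambda>x. indicator {0<..} (0 + c * x) *\<^sub>R
          (complex_of_real (0 + c * x) powr (s - 1) * f (0 + c * x)))"
    using assms(2) unfolding mellin_conv_def set_integrable_def
    by (rule lborel_integrable_real_affine) (use assms in auto)
  hence "integrable lborel (\<lambda>x. of_real c powr (s - 1) * h x)"
    by (simp only: add_0 mellin_scale_indicator[OF assms(1)] h_def)
  hence "integrable lborel (\<lambda>x. of_real c powr (1 - s) * (of_real c powr (s - 1) * h x))"
    by (rule integrable_mult_right)
  moreover have "complex_of_real c powr (1 - s) * of_real c powr (s - 1) = 1"
    using assms by (simp add: powr_add [symmetric])
  hence "(\<lambda>x. complex_of_real c powr (1 - s) * (of_real c powr (s - 1) * h x)) = h"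
    by (simp only: mult.assoc[symmetric] mult_1_left)
  ultimately show ?thesis
    unfolding mellin_conv_def set_integrable_def h_def by simp
qed

lemma mellin_scale:
  assumes "c > 0"
  shows "mellin {0<..} (\<lambda>x. f (c * x)) s = of_real c powr (-s) * mellin {0<..} f s"
proof -
  have "mellin {0<..} f s = \<bar>c\<bar> *\<^sub>R (\<integral>x. indicator {0<..} (0 + c * x) *\<^sub>R
          (complex_of_real (0 + c * x) powr (s - 1) * f (0 + c * x)) \<partial>lborel)"
    unfolding mellin_def set_lebesgue_integral_def
    by (rule lborel_integral_real_affine) (use assms in auto)
  also have "\<dots> = c *\<^sub>R (of_real c powr (s - 1) * mellin {0<..} (\<lambda>x. f (c * x)) s)"
    using assms unfolding mellin_def set_lebesgue_integral_def
    by (simp only: add_0 mellin_scale_indicator[OF assms] integral_mult_right_zero) simp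
  also have "\<dots> = of_real c powr s * mellin {0<..} (\<lambda>x. f (c * x)) s"
    using assms by (simp add: scaleR_conv_of_real powr_diff)
  finally show ?thesis
    using assms by (simp add: powr_minus field_simps)
qed

section \<open>Euler integrals: Gamma, Beta and the Cauchy kernel\<close>

text \<open>Euler's integral enters as an absolute gauge integral, that is, one over the completed
  measure. Borel measurability of the integrand, fact \<open>m\<close>, moves it to
  \<open>lborel\<close>, where Fubini and termwise integration are applied.\<close>

lemma mellin_exp_aux:
  assumes "Re s > 0"
  shows "mellin_conv {0<..} (\<lambda>x. exp (- of_real x)) s"
    and "mellin {0<..} (\<lambda>x. exp (- of_real x)) s = Gamma s"
proof -
  have eq: "(\<lambda>t. complex_of_real t powr (s - 1) / of_real (exp t)) =
            (\<lambda>x. complex_of_real x powr (s - 1) * exp (- of_real x))"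
    by (simp add: exp_minus field_simps exp_of_real)
  have 1: "(\<lambda>x. complex_of_real x powr (s - 1) * exp (- of_real x)) absolutely_integrable_on {0<..}"
    using absolutely_integrable_Gamma_integral'[OF assms] unfolding eq .
  have m: "(\<lambda>x. indicat_real {0<..} x *\<^sub>R (complex_of_real x powr (s - 1) * exp (- of_real x))) \<in> borel_measurable lborel"
    by (auto intro!: borel_measurable_continuous_on_indicator continuous_intros)
  show 2: "mellin_conv {0<..} (\<lambda>x. exp (- of_real x)) s"
    using 1 unfolding mellin_conv_def set_integrable_def by (subst (asm) integrable_completion[OF m])
  have "((\<lambda>x. complex_of_real x powr (s - 1) * exp (- of_real x)) has_integral Gamma s) {0<..}"
    using Gamma_integral_complex'[OF assms] unfolding eq .
  moreover have "((\<lambda>x. complex_of_real x powr (s - 1) * exp (- of_real x)) has_integral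
      mellin {0<..} (\<lambda>x. exp (- of_real x)) s) {0<..}"
    using has_integral_set_lebesgue[OF 1] m
    unfolding mellin_def set_lebesgue_integral_def by (simp add: integral_completion)
  ultimately show "mellin {0<..} (\<lambda>x. exp (- of_real x)) s = Gamma s"
    by (rule has_integral_unique[symmetric])
qed

lemma mellin_exp:
  assumes "Re s > 0" "a > 0"
  shows "mellin_conv {0<..} (\<lambda>x. exp (- of_real (a * x))) s"
    and "mellin {0<..} (\<lambda>x. exp (- of_real (a * x))) s = Gamma s * of_real a powr (-s)"
  using mellin_conv_scale[OF assms(2) mellin_exp_aux(1)[OF assms(1)]]
    mellin_scale[OF assms(2), of "\<lambda>x. exp (- of_real x)" s] mellin_exp_aux(2)[OF assms(1)]
  by simp_all

lemma mellin_integrand_norm: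
  assumes "x > 0"
  shows "norm (complex_of_real x powr (s - 1) * c) = x powr (Re s - 1) * norm c"
  using assms by (simp add: norm_mult norm_powr_real_powr)

text \<open>For x > 0 the norm of x powr (s - 1) depends only on Re s. A comparison may therefore
  change the imaginary part of the exponent, and convergence at the real point Re s carries over to
  s.\<close>

lemma mellin_conv_bound:
  assumes "mellin_conv S f s" "Re s = Re t" "S \<in> sets borel" "S \<subseteq> {0<..}"
    and m: "set_borel_measurable borel S g"
    and le: "\<And>x. x \<in> S \<Longrightarrow> norm (g x) \<le> norm (f x)"
  shows "mellin_conv S g t"
  unfolding mellin_conv_def
proof (rule set_integrable_bound)
  show "set_integrable lborel S (\<lambda>x. of_real x powr (s - 1) * f x)"
    using assms(1) by (simp add: mellin_conv_def)
  have "set_borel_measurable borel S (\<lambda>x. complex_of_real x powr (t - 1))"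
    unfolding set_borel_measurable_def
    by (rule borel_measurable_continuous_on_indicator)
       (use assms in \<open>auto intro!: continuous_intros\<close>)
  hence "(\<lambda>x. (indicator S x *\<^sub>R complex_of_real x powr (t - 1)) * (indicator S x *\<^sub>R g x)) \<in> borel_measurable borel"
    using m unfolding set_borel_measurable_def by (intro borel_measurable_times)
  also have "(\<lambda>x. (indicator S x *\<^sub>R complex_of_real x powr (t - 1)) * (indicator S x *\<^sub>R g x)) =
     (\<lambda>x. indicator S x *\<^sub>R (complex_of_real x powr (t - 1) * g x))"
    by (auto simp: indicator_def)
  finally show "set_borel_measurable lborel S (\<lambda>x. complex_of_real x powr (t - 1) * g x)"
    by (simp add: set_borel_measurable_def)
  show "AE x in lborel. x \<in> S \<longrightarrow> norm (complex_of_real x powr (t - 1) * g x)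
          \<le> norm (complex_of_real x powr (s - 1) * f x)"
  proof (intro AE_I2 impI)
    fix x assume x: "x \<in> S"
    hence "x > 0" using assms by auto
    thus "norm (complex_of_real x powr (t - 1) * g x)
          \<le> norm (complex_of_real x powr (s - 1) * f x)"
      using le[OF x] assms(2) by (simp add: mellin_integrand_norm mult_left_mono del: norm_mult)
  qed
qed

text \<open>Fubini for \<open>F\<close>: integrating over x first gives Gamma p * y powr (-p) * exp
  (-y), integrating over y first gives x powr (p - 1) / (1 + x).\<close>

lemma mellin_beta:
  assumes "0 < Re p" "Re p < 1"
  shows "mellin_conv {0<..} (\<lambda>x. 1 / (1 + of_real x)) p"
    and "mellin {0<..} (\<lambda>x. 1 / (1 + of_real x)) p = Gamma p * Gamma (1 - p)"
proof -
  define F where "F = (\<lambda>y x. (indicator {0<..} y * indicator {0<..} x :: real) *\<^sub>R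
     (complex_of_real x powr (p - 1) * exp (- of_real ((1 + x) * y))))"
  define G where "G = (\<lambda>q y. indicator {0<..} y *\<^sub>R
     (exp (- of_real y) * (Gamma q * complex_of_real y powr (-q))))"
  have F_eq: "F y x = (indicator {0<..} y *\<^sub>R exp (- complex_of_real y)) *
       (indicator {0<..} x *\<^sub>R (of_real x powr (p - 1) * exp (- of_real (y * x))))" for x y
    by (simp add: F_def exp_add [symmetric] algebra_simps indicator_def exp_diff)
       (simp add: exp_minus field_simps exp_add)?
  have int_x: "integrable lborel (F y)" for y
  proof (cases "y > 0")
    case True
    show ?thesis
      using mellin_exp(1)[OF assms(1) True] unfolding F_eq[abs_def] mellin_conv_def set_integrable_def
      by (rule integrable_mult_right)
  qed (simp add: F_def)
  have lint_x: "(\<integral>x. F y x \<partial>lborel) = G p y" for y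
  proof (cases "y > 0")
    case True
    thus ?thesis
      using mellin_exp(2)[OF assms(1) True]
      unfolding F_eq[abs_def] mellin_def set_lebesgue_integral_def G_def
      by (simp only: integral_mult_right_zero) simp
  qed (simp add: F_def G_def)
  have p': "0 < Re (of_real (Re p))" using assms by simp
  \<comment> \<open>Taking norms in \<open>F\<close> replaces p by its real part, so the same Gamma
    evaluation computes the inner integral of the norm.\<close>
  have norm_x: "complex_of_real (\<integral>x. norm (F y x) \<partial>lborel) = G (of_real (Re p)) y" for y
  proof -
    have "complex_of_real (norm (F y x)) = (indicator {0<..} y *\<^sub>R exp (- complex_of_real y)) *
       (indicator {0<..} x *\<^sub>R (of_real x powr (of_real (Re p) - 1) * exp (- of_real (y * x))))" for x
      unfolding F_eq
      by (auto simp: indicator_def norm_mult norm_powr_real_powr exp_of_real [symmetric] powr_of_real[symmetric])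
    hence "complex_of_real (\<integral>x. norm (F y x) \<partial>lborel) = (\<integral>x. (indicator {0<..} y *\<^sub>R exp (- complex_of_real y)) *
       (indicator {0<..} x *\<^sub>R (of_real x powr (of_real (Re p) - 1) * exp (- of_real (y * x)))) \<partial>lborel)"
      by (simp only: integral_complex_of_real [symmetric])
    thus ?thesis using mellin_exp(2)[OF p', of y]
      unfolding mellin_def set_lebesgue_integral_def G_def
      by (cases "y > 0") (simp_all only: integral_mult_right_zero, simp_all)
  qed
  have intG: "integrable lborel (G q)" if "Re q < 1" for q
  proof -
    have "integrable lborel (\<lambda>y. Gamma q * (indicator {0<..} y *\<^sub>R (of_real y powr ((1 - q) - 1) * exp (- of_real (1 * y)))))"
      using mellin_exp(1)[of "1 - q" 1] that by (intro integrable_mult_right) (simp add: mellin_conv_def set_integrable_def)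
    thus ?thesis by (simp add: G_def algebra_simps)
  qed
  have int: "integrable (lborel \<Otimes>\<^sub>M lborel) (\<lambda>(y, x). F y x)"
  proof (rule lborel_pair.Fubini_integrable)
    show "(\<lambda>(y, x). F y x) \<in> borel_measurable (lborel \<Otimes>\<^sub>M lborel)"
      unfolding F_def by measurable
    have "integrable lborel (\<lambda>y. complex_of_real (\<integral>x. norm (F y x) \<partial>lborel))"
      unfolding norm_x by (rule intG) (use assms in auto)
    thus "integrable lborel (\<lambda>y. \<integral>x. norm (case (y, x) of (y, x) \<Rightarrow> F y x) \<partial>lborel)"
      by (simp add: complex_of_real_integrable_eq)
    show "AE y in lborel. integrable lborel (\<lambda>x. case (y, x) of (y, x) \<Rightarrow> F y x)"
      using int_x by simp
  qed
  have lint_y: "(\<integral>y. F y x \<partial>lborel) = indicator {0<..} x *\<^sub>R (of_real x powr (p - 1) * (1 / (1 + of_real x)))" for x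
  proof (cases "x > 0")
    case True
    \<comment> \<open>The power y powr (1 - 1) is 1 for y > 0; it presents the integral as a Mellin
      transform at exponent 1.\<close>
    have *: "F y x = of_real x powr (p - 1) * (indicator {0<..} y *\<^sub>R (complex_of_real y powr (1 - 1) * exp (- of_real ((1 + x) * y))))" for y
      using True by (auto simp: F_def indicator_def)
    have "(\<integral>y. F y x \<partial>lborel) = of_real x powr (p - 1) * mellin {0<..} (\<lambda>y. exp (- of_real ((1 + x) * y))) 1"
      unfolding mellin_def set_lebesgue_integral_def * by (rule integral_mult_right_zero)
    also have "mellin {0<..} (\<lambda>y. exp (- of_real ((1 + x) * y))) 1 = 1 / (1 + of_real x)"
      using True by (subst mellin_exp(2)) (auto simp: powr_minus field_simps)
    finally show ?thesis using True by simp
  qed (simp add: F_def)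
  show "mellin_conv {0<..} (\<lambda>x. 1 / (1 + of_real x)) p"
    using lborel_pair.integrable_snd[of F] int unfolding mellin_conv_def set_integrable_def lint_y[symmetric] by simp
  have "mellin {0<..} (\<lambda>x. 1 / (1 + of_real x)) p = (\<integral>x. (\<integral>y. F y x \<partial>lborel) \<partial>lborel)"
    unfolding mellin_def set_lebesgue_integral_def lint_y ..
  also have "\<dots> = (\<integral>y. G p y \<partial>lborel)"
    using lborel_pair.Fubini_integral[OF int] by (simp add: lint_x)
  also have "\<dots> = (\<integral>y. Gamma p * (indicator {0<..} y *\<^sub>R (of_real y powr ((1 - p) - 1) * exp (- of_real (1 * y)))) \<partial>lborel)"
    by (intro Bochner_Integration.integral_cong) (auto simp: G_def)
  also have "\<dots> = Gamma p * Gamma (1 - p)"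
    using mellin_exp(2)[of "1 - p" 1] assms
    by (subst integral_mult_right_zero) (simp add: mellin_def set_lebesgue_integral_def)
  finally show "mellin {0<..} (\<lambda>x. 1 / (1 + of_real x)) p = Gamma p * Gamma (1 - p)" .
qed

lemma sqrt_powr_complex:
  assumes "t > 0"
  shows "complex_of_real (sqrt t) powr w = of_real t powr (w / 2)"
proof -
  have "complex_of_real t powr (w / 2) = (of_real (sqrt t) * of_real (sqrt t)) powr (w / 2)"
    using assms by (simp flip: of_real_mult)
  also have "\<dots> = of_real (sqrt t) powr (w / 2) * of_real (sqrt t) powr (w / 2)"
    using assms by (intro powr_times_real) auto
  also have "\<dots> = of_real (sqrt t) powr w"
    by (simp flip: powr_add)
  finally show ?thesis ..
qed

lemma one_plus_of_real_square_nonzero: "1 + complex_of_real t ^ 2 \<noteq> 0"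
proof -
  have "1 + t ^ 2 \<noteq> 0" by (smt (verit) zero_le_power2)
  thus ?thesis by (metis of_real_add of_real_1 of_real_power of_real_eq_0_iff)
qed

text \<open>The substitution x = sqrt t halves the exponent and reduces the integral to
  \<open>mellin_beta\<close>.\<close>

lemma mellin_beta_square:
  assumes "0 < Re v" "Re v < 2"
  shows "mellin_conv {0<..} (\<lambda>x. 1 / (1 + of_real x ^ 2)) v"
    and "mellin {0<..} (\<lambda>x. 1 / (1 + of_real x ^ 2)) v = Gamma (v / 2) * Gamma (1 - v / 2) / 2"
proof -
  define f where "f = (\<lambda>w x. complex_of_real x powr (w - 1) * (1 / (1 + of_real x ^ 2)))"
  define f\<^sub>R where "f\<^sub>R = (\<lambda>x. x powr (Re v - 1) * (1 / (1 + x ^ 2)))"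
  define g' where "g' = (\<lambda>t. inverse (sqrt t) / 2)"
  have ei: "einterval 0 \<infinity> = {0<..}"
    by (auto simp: einterval_def zero_ereal_def)
  have sub: "g' t *\<^sub>R f w (sqrt t) = 1 / 2 * (of_real t powr (w / 2 - 1) * (1 / (1 + of_real t)))"
    if "t > 0" for t w
  proof -
    have "complex_of_real (g' t) = 1 / 2 * of_real (sqrt t) powr (-1)"
      using that by (simp add: g'_def powr_minus field_simps flip: of_real_inverse)
    also have "\<dots> = 1 / 2 * of_real t powr (- 1 / 2)"
      using sqrt_powr_complex[OF that, of "-1"] by simp
    finally have gt: "complex_of_real (g' t) = 1 / 2 * of_real t powr (- 1 / 2)" .
    have sq: "complex_of_real (sqrt t) ^ 2 = of_real t"
      using that by (simp flip: of_real_power)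
    have "g' t *\<^sub>R f w (sqrt t) = 1 / 2 * (of_real t powr (- 1 / 2) * of_real t powr ((w - 1) / 2)) * (1 / (1 + of_real t))"
      unfolding f_def scaleR_conv_of_real gt sq sqrt_powr_complex[OF that] by (simp only: mult_ac)
    also have "complex_of_real t powr (- 1 / 2) * of_real t powr ((w - 1) / 2) = of_real t powr (w / 2 - 1)"
    proof -
      have "- 1 / 2 + (w - 1) / 2 = w / 2 - 1" by (simp add: diff_divide_distrib)
      thus ?thesis using powr_add[of "complex_of_real t" "- 1 / 2" "(w - 1) / 2"] by metis
    qed
    finally show ?thesis by (simp add: mult_ac)
  qed
  have int_sub: "set_integrable lborel {0<..} (\<lambda>t. g' t *\<^sub>R f w (sqrt t))" if "0 < Re w" "Re w < 2" for w
  proof -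
    have "set_integrable lborel {0<..} (\<lambda>t. 1 / 2 * (complex_of_real t powr (w / 2 - 1) * (1 / (1 + of_real t))))"
      using mellin_beta(1)[of "w / 2"] that unfolding mellin_conv_def
      by (intro set_integrable_mult_right) auto
    thus ?thesis
      by (rule set_integrable_cong[THEN iffD1, rotated 3]) (auto simp: sub)
  qed
  have fR: "complex_of_real (f\<^sub>R x) = f (of_real (Re v)) x" if "x > 0" for x
    using that by (simp add: f_def f\<^sub>R_def powr_of_real [symmetric])
  have A: "((ereal \<circ> sqrt \<circ> real_of_ereal) \<longlongrightarrow> 0) (at_right 0)"
    unfolding zero_ereal_def by (subst ereal_tendsto_simps) (auto simp: o_def intro!: tendsto_eq_intros)
  have B: "((ereal \<circ> sqrt \<circ> real_of_ereal) \<longlongrightarrow> \<infinity>) (at_left \<infinity>)"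
    by (subst ereal_tendsto_simps, subst ereal_tendsto_simps) (rule sqrt_at_top)
  \<comment> \<open>The complex substitution rule presupposes integrability on both sides. It comes
    from the rule for nonnegative integrands, applied at the real exponent Re v.\<close>
  have "set_integrable lborel (einterval 0 \<infinity>) f\<^sub>R"
  proof (rule interval_integral_substitution_nonneg[where g = sqrt and g' = g' and a = 0 and b = \<infinity>])
    have "set_integrable lborel {0<..} (\<lambda>t. complex_of_real (f\<^sub>R (sqrt t) * g' t))"
      by (rule set_integrable_cong[THEN iffD1, OF refl refl _ int_sub[of "of_real (Re v)"]])
         (use assms fR in \<open>auto simp: scaleR_conv_of_real\<close>)
    thus "set_integrable lborel (einterval 0 \<infinity>) (\<lambda>x. f\<^sub>R (sqrt x) * g' x)"
      unfolding ei set_integrable_def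
      by (simp add: scaleR_conv_of_real complex_of_real_integrable_eq flip: of_real_mult)
  qed (use A B in \<open>auto simp: zero_ereal_def g'_def f\<^sub>R_def intro!: derivative_eq_intros continuous_intros\<close>)
  hence "set_integrable lborel {0<..} (\<lambda>x. complex_of_real (f\<^sub>R x))"
    unfolding ei set_integrable_def by (simp add: scaleR_conv_of_real complex_of_real_integrable_eq flip: of_real_mult)
  hence "mellin_conv {0<..} (\<lambda>x. 1 / (1 + of_real x ^ 2)) (of_real (Re v))"
    unfolding mellin_conv_def
    by (rule set_integrable_cong[THEN iffD1, rotated 3]) (auto simp: fR, auto simp: f_def)
  thus conv: "mellin_conv {0<..} (\<lambda>x. 1 / (1 + of_real x ^ 2)) v"
    by (rule mellin_conv_bound) (auto simp: set_borel_measurable_def)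
  have "(LBINT x=0..\<infinity>. f v x) = (LBINT t=0..\<infinity>. g' t *\<^sub>R f v (sqrt t))"
  proof (rule interval_integral_substitution_integrable)
    show "set_integrable lborel (einterval 0 \<infinity>) (\<lambda>x. g' x *\<^sub>R f v (sqrt x))"
      unfolding ei by (rule int_sub) (use assms in auto)
    show "set_integrable lborel (einterval 0 \<infinity>) (f v)"
      using conv unfolding ei mellin_conv_def f_def .
    show "isCont (f v) (sqrt x)" if "0 < ereal x" for x
      using that unfolding f_def
      by (intro continuous_intros one_plus_of_real_square_nonzero) (auto simp: zero_ereal_def)
  qed (use A B in \<open>auto simp: zero_ereal_def g'_def intro!: derivative_eq_intros continuous_intros\<close>)
  hence "mellin {0<..} (\<lambda>x. 1 / (1 + of_real x ^ 2)) v = (LINT t:{0<..}|lborel. g' t *\<^sub>R f v (sqrt t))"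
    by (simp add: interval_lebesgue_integral_def ei mellin_def f_def)
  also have "\<dots> = (LINT t:{0<..}|lborel. 1 / 2 * (complex_of_real t powr (v / 2 - 1) * (1 / (1 + of_real t))))"
    by (intro set_lebesgue_integral_cong) (auto simp: sub)
  also have "\<dots> = 1 / 2 * mellin {0<..} (\<lambda>x. 1 / (1 + of_real x)) (v / 2)"
    unfolding mellin_def by (rule set_integral_mult_right)
  finally show "mellin {0<..} (\<lambda>x. 1 / (1 + of_real x ^ 2)) v = Gamma (v / 2) * Gamma (1 - v / 2) / 2"
    using mellin_beta(2)[of "v / 2"] assms by simp
qed

text \<open>Since \<open>1 / (t - \<i> \<epsilon>) = (t + \<i> \<epsilon>) / (1 + t\<^sup>2)\<close>, no contour rotation is needed.\<close>

lemma mellin_cauchy_kernel: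
  assumes u: "0 < Re u" "Re u < 1" and \<epsilon>: "\<epsilon> = 1 \<or> \<epsilon> = (-1 :: complex)"
  shows "mellin_conv {0<..} (\<lambda>t. 1 / (of_real t - \<i> * \<epsilon>)) u"
    and "mellin {0<..} (\<lambda>t. 1 / (of_real t - \<i> * \<epsilon>)) u =
           of_real pi / sin (of_real pi * u) * exp (- (\<i> * \<epsilon> * of_real pi * (u - 1) / 2))"
proof -
  define h where "h = (\<lambda>t. 1 / (1 + complex_of_real t ^ 2))"
  have eq: "complex_of_real t powr (u - 1) * (1 / (of_real t - \<i> * \<epsilon>)) =
      of_real t powr ((u + 1) - 1) * h t + \<i> * \<epsilon> * (of_real t powr (u - 1) * h t)" if "t \<in> {0<..}" for t
  proof -
    have *: "(of_real t - \<i> * \<epsilon>) * (of_real t + \<i> * \<epsilon>) = 1 + complex_of_real t ^ 2"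
      using \<epsilon> by (auto simp: algebra_simps power2_eq_square)
    hence "1 / (of_real t - \<i> * \<epsilon>) = (of_real t + \<i> * \<epsilon>) * h t"
      using one_plus_of_real_square_nonzero[of t] unfolding h_def *[symmetric] by simp
    moreover have "complex_of_real t powr ((u + 1) - 1) = of_real t powr (u - 1) * of_real t"
      using that by (simp add: powr_diff)
    ultimately show ?thesis by (simp add: algebra_simps)
  qed
  \<comment> \<open>The exponents u and u + 1 both lie in the strip 0 < Re < 2 of
    \<open>mellin_beta_square\<close>; this is what 0 < Re u < 1 is for.\<close>
  have 1: "set_integrable lborel {0<..} (\<lambda>t. complex_of_real t powr ((u + 1) - 1) * h t)"
    using mellin_beta_square(1)[of "u + 1"] u unfolding mellin_conv_def h_def by simp
  have 2: "set_integrable lborel {0<..} (\<lambda>t. \<i> * \<epsilon> * (complex_of_real t powr (u - 1) * h t))"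
    using mellin_beta_square(1)[of u] u unfolding mellin_conv_def h_def by (intro set_integrable_mult_right) simp
  show "mellin_conv {0<..} (\<lambda>t. 1 / (of_real t - \<i> * \<epsilon>)) u"
    unfolding mellin_conv_def
    by (rule set_integrable_cong[THEN iffD1, OF refl refl _ set_integral_add(1)[OF 1 2]]) (rule eq[symmetric])
  have "mellin {0<..} (\<lambda>t. 1 / (of_real t - \<i> * \<epsilon>)) u = mellin {0<..} h (u + 1) + \<i> * \<epsilon> * mellin {0<..} h u"
    unfolding mellin_def
    by (subst set_integral_mult_right [symmetric], subst set_integral_add(2)[OF 1 2, symmetric],
        rule set_lebesgue_integral_cong) (simp, use eq in blast)
  also have "mellin {0<..} h (u + 1) = of_real pi / sin (of_real pi * ((u + 1) / 2)) / 2"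
    unfolding h_def by (subst mellin_beta_square(2)) (use u in \<open>auto simp: Gamma_reflection_complex\<close>)
  also have "mellin {0<..} h u = of_real pi / sin (of_real pi * (u / 2)) / 2"
    unfolding h_def by (subst mellin_beta_square(2)) (use u in \<open>auto simp: Gamma_reflection_complex\<close>)
  also have "of_real pi * ((u + 1) / 2) = of_real pi / 2 - (- (of_real pi * u / 2))"
    by (simp add: algebra_simps add_divide_distrib)
  also have "sin (of_real pi / 2 - (- (of_real pi * u / 2))) = cos (of_real pi * u / 2)"
    by (simp only: cos_sin_eq [symmetric] cos_minus)
  \<comment> \<open>With y = pi u / 2 the common denominator is sin (2y) = 2 sin y cos y, and the
    numerator sin y + i\<epsilon> cos y is the exponential of i\<epsilon>(pi/2 - y).\<close>
  also have "of_real pi / cos (of_real pi * u / 2) / 2 + \<i> * \<epsilon> * (of_real pi / sin (of_real pi * (u / 2)) / 2) =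
    of_real pi / sin (of_real pi * u) * exp (- (\<i> * \<epsilon> * of_real pi * (u - 1) / 2))"
  proof -
    define y where "y = of_real pi * u / 2"
    have s: "sin (2 * y) \<noteq> 0"
    proof
      assume "sin (2 * y) = 0"
      then obtain n :: int where "2 * y = of_real (of_int n * pi)"
        unfolding sin_eq_0 by blast
      hence "u = of_int n" by (simp add: y_def)
      hence "0 < n" "n < 1" using u by auto
      thus False by linarith
    qed
    hence sc: "sin y \<noteq> 0" "cos y \<noteq> 0" unfolding sin_double by auto
    have e: "exp (- (\<i> * \<epsilon> * of_real pi * (u - 1) / 2)) = sin y + \<i> * \<epsilon> * cos y"
    proof -
      have "- (\<i> * \<epsilon> * of_real pi * (u - 1) / 2) = \<i> * (\<epsilon> * (of_real pi / 2 - y))"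
        by (simp add: y_def algebra_simps diff_divide_distrib)
      also have "exp (\<i> * (\<epsilon> * (of_real pi / 2 - y))) = cos (\<epsilon> * (of_real pi / 2 - y)) + \<i> * sin (\<epsilon> * (of_real pi / 2 - y))"
        by (rule exp_Euler)
      also have "\<dots> = cos (of_real pi / 2 - y) + \<i> * \<epsilon> * sin (of_real pi / 2 - y)"
        using \<epsilon>
      proof (elim disjE)
        assume "\<epsilon> = 1"
        thus ?thesis by (simp only: mult_1_left mult_1_right)
      next
        assume "\<epsilon> = - 1"
        thus ?thesis
          by (simp only: mult_1_left mult_1_right mult_minus1 mult_minus1_right mult_minus_left mult_minus_right cos_minus sin_minus)
      qed
      also have "cos (of_real pi / 2 - y) = sin y"
        by (rule sin_cos_eq [symmetric])
      also have "sin (of_real pi / 2 - y) = cos y"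
        by (rule cos_sin_eq [symmetric])
      finally show ?thesis .
    qed
    have y: "of_real pi * u = 2 * y" "of_real pi * (u / 2) = y" "2 * y / 2 = y" by (simp_all add: y_def)
    have "of_real pi / cos y / 2 + \<i> * \<epsilon> * (of_real pi / sin y / 2) =
        of_real pi / (2 * sin y * cos y) * (sin y + \<i> * \<epsilon> * cos y)"
      using sc by (simp add: add_divide_distrib distrib_left mult_ac)
    thus ?thesis unfolding e y sin_double .
  qed
  finally show "mellin {0<..} (\<lambda>t. 1 / (of_real t - \<i> * \<epsilon>)) u =
           of_real pi / sin (of_real pi * u) * exp (- (\<i> * \<epsilon> * of_real pi * (u - 1) / 2))" .
qed

section \<open>Termwise transforms and increments of Digamma\<close>

text \<open>Summability of the integrated norms is phrased through the Mellin transform of the norms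
  at Re s, so that the evaluation and scaling lemmas for transforms also verify it. The outer
  \<open>norm\<close> in \<open>sums\<close> only turns a nonnegative complex number into a real
  one.\<close>

lemma mellin_suminf:
  assumes S: "S \<subseteq> {0<..}"
    and conv: "\<And>n. mellin_conv S (f n) s"
    and pw: "\<And>x. x \<in> S \<Longrightarrow> summable (\<lambda>n. norm (f n x))"
    and sums: "summable (\<lambda>n::nat. norm (mellin S (\<lambda>x. of_real (norm (f n x))) (of_real (Re s))))"
  shows "mellin_conv S (\<lambda>x. \<Sum>n. f n x) s"
    and "(\<lambda>n. mellin S (f n) s) sums mellin S (\<lambda>x. \<Sum>n. f n x) s"
proof -
  define F where "F = (\<lambda>n x. indicator S x *\<^sub>R (complex_of_real x powr (s - 1) * f n x))"
  have F: "integrable lborel (F n)" for n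
    using conv unfolding F_def mellin_conv_def set_integrable_def .
  have nF: "complex_of_real (norm (F n x)) =
      indicator S x *\<^sub>R (complex_of_real x powr (of_real (Re s) - 1) * of_real (norm (f n x)))" for n x
    using S by (cases "x \<in> S") (auto simp: F_def norm_mult norm_powr_real_powr powr_of_real[symmetric])
  have "complex_of_real (\<integral>x. norm (F n x) \<partial>lborel) =
      mellin S (\<lambda>x. of_real (norm (f n x))) (of_real (Re s))" for n
    unfolding mellin_def set_lebesgue_integral_def nF[symmetric] by (rule integral_complex_of_real [symmetric])
  hence "norm (complex_of_real (\<integral>x. norm (F n x) \<partial>lborel)) =
      norm (mellin S (\<lambda>x. of_real (norm (f n x))) (of_real (Re s)))" for n
    by simp
  hence lint: "(\<integral>x. norm (F n x) \<partial>lborel) =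
      norm (mellin S (\<lambda>x. of_real (norm (f n x))) (of_real (Re s)))" for n
    by (simp add: Bochner_Integration.integral_nonneg)
  have "summable (\<lambda>n. norm (F n x))" for x
  proof (cases "x \<in> S")
    case True
    thus ?thesis using pw[OF True] by (simp add: F_def norm_mult summable_mult)
  qed (simp add: F_def)
  hence pw': "AE x in lborel. summable (\<lambda>n. norm (F n x))" by simp
  have sums': "summable (\<lambda>n. \<integral>x. norm (F n x) \<partial>lborel)"
    using sums unfolding lint .
  have sF: "(\<Sum>n. F n x) = indicator S x *\<^sub>R (complex_of_real x powr (s - 1) * (\<Sum>n. f n x))" for x
    using summable_norm_cancel[OF pw[of x]]
    by (cases "x \<in> S") (auto simp: F_def suminf_mult)
  show "mellin_conv S (\<lambda>x. \<Sum>n. f n x) s"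
    using integrable_suminf[OF F pw' sums'] unfolding sF mellin_conv_def set_integrable_def .
  show "(\<lambda>n. mellin S (f n) s) sums mellin S (\<lambda>x. \<Sum>n. f n x) s"
    using sums_integral[OF F pw' sums']
    unfolding sF unfolding F_def mellin_def set_lebesgue_integral_def .
qed

lemma summable_shifted_powr:
  assumes "\<alpha> > 0" "\<sigma> < -1"
  shows "summable (\<lambda>n. (\<alpha> + real n) powr \<sigma>)"
proof (rule summable_comparison_test)
  show "\<exists>N. \<forall>n\<ge>N. norm ((\<alpha> + real n) powr \<sigma>) \<le> real n powr \<sigma>"
    using assms by (intro exI[of _ 1]) (auto intro!: powr_mono2')
  show "summable (\<lambda>n. real n powr \<sigma>)" using assms by (simp add: summable_real_powr_iff)
qed

text \<open>The terms 1/(n + 1) and Euler's constant in the series of Digamma cancel in a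
  difference.\<close>

lemma Digamma_diff_sums:
  fixes z w :: complex
  assumes "z \<noteq> 0" "w \<noteq> 0"
  shows "(\<lambda>n. 1 / (w + of_nat n) - 1 / (z + of_nat n)) sums (Digamma z - Digamma w)"
proof -
  have "(\<lambda>n. inverse (of_nat (n+1)) - inverse (y + of_nat n)) sums (Digamma y + euler_mascheroni)"
    if "y \<noteq> 0" for y :: complex
    using summable_Digamma[OF that] by (simp add: Digamma_def summable_sums)
  from sums_diff[OF this[OF assms(1)] this[OF assms(2)]] show ?thesis
    by (simp add: divide_inverse algebra_simps)
qed

text \<open>The n-th term in the series of \<open>f\<close> is 1/Y - 1/(Y + i\<epsilon>x) with Y =
  \<alpha> + n, which equals \<psi>(x/Y)/Y for the single function \<psi>(t) = t/(t - i\<epsilon>).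
  Scaling turns it into Y powr (s - 1) times a transform independent of n. As \<psi>(t) is O(t) at 0
  and tends to 1 at infinity, the strip is -1 < Re s < 0.\<close>

lemma mellin_Digamma:
  assumes s: "-1 < Re s" "Re s < 0" and \<alpha>: "\<alpha> > 0" and \<epsilon>: "\<epsilon> = 1 \<or> \<epsilon> = (-1 :: complex)"
  defines "f \<equiv> (\<lambda>x. Digamma (of_real \<alpha> + \<i> * \<epsilon> * of_real x) - Digamma (of_real \<alpha>))"
  shows "mellin_conv {0<..} f s"
    and "mellin {0<..} f s = - (of_real pi / sin (of_real pi * s) * exp (- (\<i> * \<epsilon> * of_real pi * s / 2))) *
           (\<Sum>n. of_real (\<alpha> + real n) powr (s - 1))"
proof -
  define \<psi> where "\<psi> = (\<lambda>t. complex_of_real t / (of_real t - \<i> * \<epsilon>))"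
  define Y where "Y = (\<lambda>n. \<alpha> + real n)"
  have Y: "Y n > 0" for n using \<alpha> by (simp add: Y_def)
  define \<phi> where "\<phi> = (\<lambda>n x. of_real (1 / Y n) * \<psi> (1 / Y n * x))"
  define C where "C = - (of_real pi / sin (of_real pi * s) * exp (- (\<i> * \<epsilon> * of_real pi * s / 2)))"
  have nz: "of_real y + \<i> * \<epsilon> * of_real x \<noteq> 0" "of_real x - \<i> * \<epsilon> * of_real y \<noteq> 0" if "y > 0" for x y
    using that \<epsilon> by (auto simp: complex_eq_iff)
  \<comment> \<open>The numerator t raises the exponent by one, so the Cauchy kernel is used at u =
    s + 1; sin (pi (s + 1)) then supplies the minus sign in \<open>C\<close>.\<close>
  have shift: "complex_of_real t powr (s - 1) * \<psi> t =
      complex_of_real t powr ((s + 1) - 1) * (1 / (of_real t - \<i> * \<epsilon>))" if "t \<in> {0<..}" for t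
    using that by (simp add: \<psi>_def powr_diff)
  have \<psi>1: "mellin_conv {0<..} \<psi> s"
    unfolding mellin_conv_def
    by (rule set_integrable_cong[THEN iffD1, OF refl refl _
          mellin_cauchy_kernel(1)[OF _ _ \<epsilon>, of "s + 1", unfolded mellin_conv_def]])
       (use s in \<open>auto simp: shift\<close>)
  have "mellin {0<..} \<psi> s = mellin {0<..} (\<lambda>t. 1 / (of_real t - \<i> * \<epsilon>)) (s + 1)"
    unfolding mellin_def by (rule set_lebesgue_integral_cong) (simp, use shift in blast)
  also have "\<dots> = of_real pi / sin (of_real pi * (s + 1)) * exp (- (\<i> * \<epsilon> * of_real pi * s / 2))"
    using s by (subst mellin_cauchy_kernel(2)[OF _ _ \<epsilon>]) auto
  also have "sin (of_real pi * (s + 1)) = - sin (of_real pi * s)"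
    by (simp add: distrib_left sin_plus_pi)
  finally have \<psi>2: "mellin {0<..} \<psi> s = C" by (simp add: C_def)
  have scale_gen: "mellin {0<..} (\<lambda>x. of_real (1 / Y n) * g (1 / Y n * x)) w = of_real (Y n) powr (w - 1) * mellin {0<..} g w"
    for g w n
  proof -
    have "mellin {0<..} (\<lambda>x. of_real (1 / Y n) * g (1 / Y n * x)) w =
        of_real (1 / Y n) * mellin {0<..} (\<lambda>x. g (1 / Y n * x)) w"
      unfolding mellin_def by (subst set_integral_mult_right [symmetric]) (simp add: mult_ac)
    also have "\<dots> = of_real (1 / Y n) * (of_real (1 / Y n) powr (- w) * mellin {0<..} g w)"
      using Y[of n] by (subst mellin_scale) auto
    also have "complex_of_real (1 / Y n) powr (-w) = of_real (Y n) powr w"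
      using of_real_inverse_powr[OF Y[of n], of "-w"] by simp
    also have "complex_of_real (1 / Y n) * (of_real (Y n) powr w * mellin {0<..} g w) =
        of_real (Y n) powr (w - 1) * mellin {0<..} g w"
      using Y[of n] by (simp add: powr_diff)
    finally show ?thesis .
  qed
  have f_sum: "f x = (\<Sum>n. \<phi> n x)" if "x > 0" for x
  proof -
    have "1 / (of_real \<alpha> + of_nat n) - 1 / (of_real \<alpha> + \<i> * \<epsilon> * of_real x + of_nat n) = \<phi> n x" for n
    proof -
      have "\<phi> n x = of_real x / (of_real (Y n) * (of_real x - \<i> * \<epsilon> * of_real (Y n)))"
        using Y[of n] nz(2)[OF Y[of n]] nz(2)[of 1 "x / Y n"] by (simp add: \<phi>_def \<psi>_def field_simps)
      also have "\<dots> = \<i> * \<epsilon> * of_real x / (of_real (Y n) * (of_real (Y n) + \<i> * \<epsilon> * of_real x))"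
        using Y[of n] nz(1)[OF Y[of n]] nz(2)[OF Y[of n]] \<epsilon> by (auto simp: divide_simps) (auto simp: algebra_simps)
      also have "\<dots> = 1 / of_real (Y n) - 1 / (of_real (Y n) + \<i> * \<epsilon> * of_real x)"
        using Y[of n] nz(1)[OF Y[of n]] by (simp add: divide_simps)
      finally show ?thesis by (simp add: Y_def add_ac)
    qed
    moreover have "of_real \<alpha> + \<i> * \<epsilon> * of_real x \<noteq> 0" "of_real \<alpha> \<noteq> (0 :: complex)"
      using nz \<alpha> by auto
    ultimately show ?thesis
      using Digamma_diff_sums[of "of_real \<alpha> + \<i> * \<epsilon> * of_real x" "of_real \<alpha>"]
      by (simp add: f_def sums_iff)
  qed
  have bound: "norm (\<phi> n x) \<le> x * Y n powr (-2)" if "x > 0" for n x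
  proof -
    \<comment> \<open>The denominator t - i\<epsilon> has imaginary part of modulus 1, hence norm at
      least 1 for every real t.\<close>
    have "1 = \<bar>Im (of_real (1 / Y n * x) - \<i> * \<epsilon>)\<bar>" using \<epsilon> by auto
    also have "\<dots> \<le> norm (of_real (1 / Y n * x) - \<i> * \<epsilon>)" by (rule abs_Im_le_cmod)
    finally have "norm (\<psi> (1 / Y n * x)) \<le> 1 / Y n * x / 1"
      unfolding \<psi>_def norm_divide using that Y[of n] by (intro frac_le) (auto simp: norm_divide)
    hence "norm (\<phi> n x) \<le> 1 / Y n * (1 / Y n * x)"
      unfolding \<phi>_def norm_mult using Y[of n] by (intro mult_mono) (auto simp: norm_divide)
    also have "\<dots> = x * Y n powr (-2)"
      using Y[of n] by (simp add: powr_minus powr_numeral field_simps power2_eq_square)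
    finally show ?thesis .
  qed
  have pw: "summable (\<lambda>n. norm (\<phi> n x))" if "x \<in> {0<..}" for x
  proof (rule summable_comparison_test')
    show "summable (\<lambda>n. x * Y n powr (-2))"
      using summable_shifted_powr[OF \<alpha>, of "-2"] by (intro summable_mult) (simp add: Y_def)
  qed (use bound that in auto)
  have conv: "mellin_conv {0<..} (\<phi> n) s" for n
  proof -
    have "mellin_conv {0<..} (\<lambda>x. \<psi> (1 / Y n * x)) s"
      by (rule mellin_conv_scale[OF _ \<psi>1]) (use Y in simp)
    hence "set_integrable lborel {0<..} (\<lambda>x. of_real (1 / Y n) * (of_real x powr (s - 1) * \<psi> (1 / Y n * x)))"
      unfolding mellin_conv_def by (intro set_integrable_mult_right) auto
    thus ?thesis unfolding mellin_conv_def \<phi>_def by (simp add: mult_ac)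
  qed
  have sums: "summable (\<lambda>n. norm (mellin {0<..} (\<lambda>x. of_real (norm (\<phi> n x))) (of_real (Re s))))"
  proof -
    \<comment> \<open>The norms scale as the terms do, so the n-th value is a constant times Y powr
      (Re s - 1), summable because Re s < 0.\<close>
    have "mellin {0<..} (\<lambda>x. of_real (norm (\<phi> n x))) (of_real (Re s)) =
       of_real (Y n) powr (of_real (Re s) - 1) * mellin {0<..} (\<lambda>x. of_real (norm (\<psi> x))) (of_real (Re s))" for n
      using scale_gen[of n "\<lambda>x. of_real (norm (\<psi> x))" "of_real (Re s)"] Y[of n] by (simp add: \<phi>_def norm_mult norm_divide)
    hence "norm (mellin {0<..} (\<lambda>x. of_real (norm (\<phi> n x))) (of_real (Re s))) =
       Y n powr (Re s - 1) * norm (mellin {0<..} (\<lambda>x. of_real (norm (\<psi> x))) (of_real (Re s)))" for n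
      using Y[of n] by (simp add: norm_mult norm_powr_real_powr)
    thus ?thesis
      using summable_shifted_powr[OF \<alpha>, of "Re s - 1"] s by (simp add: Y_def summable_mult2)
  qed
  note * = mellin_suminf[OF subset_refl conv pw sums]
  show "mellin_conv {0<..} f s"
    using *(1) unfolding mellin_conv_def
    by (rule set_integrable_cong[THEN iffD1, rotated 3]) (auto simp: f_sum)
  have "mellin {0<..} f s = mellin {0<..} (\<lambda>x. \<Sum>n. \<phi> n x) s"
    unfolding mellin_def by (rule set_lebesgue_integral_cong) (auto simp: f_sum)
  also have "\<dots> = (\<Sum>n. of_real (Y n) powr (s - 1) * C)"
    using *(2) scale_gen[of _ \<psi> s] by (simp add: sums_iff \<psi>2 \<phi>_def)
  also have "\<dots> = C * (\<Sum>n. of_real (Y n) powr (s - 1))"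
  proof (subst suminf_mult2 [symmetric])
    show "summable (\<lambda>n. complex_of_real (Y n) powr (s - 1))"
      by (rule summable_norm_cancel)
         (use summable_shifted_powr[OF \<alpha>, of "Re s - 1"] s Y in \<open>simp add: norm_powr_real_powr Y_def less_imp_le\<close>)
  qed simp
  finally show "mellin {0<..} f s = - (of_real pi / sin (of_real pi * s) * exp (- (\<i> * \<epsilon> * of_real pi * s / 2))) *
           (\<Sum>n. of_real (\<alpha> + real n) powr (s - 1))"
    by (simp add: C_def Y_def)
qed

section \<open>Analytic continuation of Mellin transforms\<close>

text \<open>The correcting factor x powr (s - t) has norm at most 1 on S. Thus the real part may
  grow on (0, 1) and shrink on (1, \<infinity>).\<close>

lemma mellin_conv_mono:
  assumes conv: "mellin_conv S f t" and S: "S \<in> sets borel" "S \<subseteq> {0<..}"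
    and m: "set_borel_measurable borel S f"
    and le: "\<And>x. x \<in> S \<Longrightarrow> x powr Re s \<le> x powr Re t"
  shows "mellin_conv S f s"
proof -
  define f' where "f' = (\<lambda>x. complex_of_real x powr (s - t) * f x)"
  have "mellin_conv S f' t"
  proof (rule mellin_conv_bound[OF conv refl S])
    have "set_borel_measurable borel S (\<lambda>x. complex_of_real x powr (s - t))"
      unfolding set_borel_measurable_def
      by (rule borel_measurable_continuous_on_indicator)
         (use S in \<open>auto intro!: continuous_intros\<close>)
    hence "(\<lambda>x. (indicator S x *\<^sub>R complex_of_real x powr (s - t)) * (indicator S x *\<^sub>R f x)) \<in> borel_measurable borel"
      using m unfolding set_borel_measurable_def by (intro borel_measurable_times)
    also have "(\<lambda>x. (indicator S x *\<^sub>R complex_of_real x powr (s - t)) * (indicator S x *\<^sub>R f x)) =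
       (\<lambda>x. indicator S x *\<^sub>R f' x)"
      by (auto simp: indicator_def f'_def)
    finally show "set_borel_measurable borel S f'"
      by (simp add: set_borel_measurable_def)
    show "norm (f' x) \<le> norm (f x)" if "x \<in> S" for x
    proof -
      have x: "x > 0" using that S by auto
      hence "x powr (Re s - Re t) \<le> 1"
        using le[OF that] by (simp add: powr_diff)
      hence "x powr (Re s - Re t) * norm (f x) \<le> 1 * norm (f x)"
        by (intro mult_right_mono) auto
      thus ?thesis using x by (simp add: f'_def norm_mult norm_powr_real_powr)
    qed
  qed
  thus ?thesis unfolding mellin_conv_def
    by (rule set_integrable_cong[THEN iffD1, OF refl refl, rotated])
       (use S in \<open>auto simp: f'_def mult.assoc [symmetric] simp flip: powr_add\<close>)
qed

lemma mellin_conv_subset: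
  assumes "mellin_conv T f s" "S \<in> sets borel" "S \<subseteq> T"
  shows "mellin_conv S f s"
  using assms unfolding mellin_conv_def by (auto intro: set_integrable_subset)

lemma mellin_split_at_1:
  assumes "mellin_conv {0<..} f s"
  shows "mellin {0<..} f s = mellin {0<..<1} f s + mellin {1<..} f s"
proof -
  have "mellin {0<..} f s = mellin ({0<..<1} \<union> {1<..}) f s"
    unfolding mellin_def
  proof (rule set_integral_cong_set)
    have "set_integrable lborel ({0<..<1} \<union> {1<..}) (\<lambda>x. complex_of_real x powr (s - 1) * f x)"
      using assms unfolding mellin_conv_def by (rule set_integrable_subset) auto
    thus "set_borel_measurable lborel ({0<..<1} \<union> {1<..}) (\<lambda>x. complex_of_real x powr (s - 1) * f x)"
      unfolding set_borel_measurable_def set_integrable_def by (rule borel_measurable_integrable)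
    show "set_borel_measurable lborel {0<..} (\<lambda>x. complex_of_real x powr (s - 1) * f x)"
      using assms unfolding mellin_conv_def set_borel_measurable_def set_integrable_def
      by (rule borel_measurable_integrable)
    show "AE x in lborel. (x \<in> ({0<..<1} \<union> {1::real<..})) = (x \<in> {0<..})"
      using AE_lborel_singleton[of "1::real"] by eventually_elim auto
  qed
  also have "\<dots> = mellin {0<..<1} f s + mellin {1<..} f s"
    unfolding mellin_def
    by (rule set_integral_Un)
       (use assms in \<open>auto simp: mellin_conv_def elim!: set_integrable_subset\<close>)
  finally show ?thesis .
qed

text \<open>Extended real endpoints let one statement serve (0, 1) and (1, \<infinity>). The real
  antiderivative, with its nonnegative integrand, gives integrability; the complex one then gives
  the value.\<close>

lemma
  assumes a: "0 \<le> a" "a < b" and w: "w \<noteq> 0"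
    and A: "(((\<lambda>x. of_real x powr w / w) \<circ> real_of_ereal) \<longlongrightarrow> A) (at_right a)"
    and B: "(((\<lambda>x. of_real x powr w / w) \<circ> real_of_ereal) \<longlongrightarrow> B) (at_left b)"
    and A': "(((\<lambda>x. x powr Re w / Re w) \<circ> real_of_ereal) \<longlongrightarrow> A') (at_right a)"
    and B': "(((\<lambda>x. x powr Re w / Re w) \<circ> real_of_ereal) \<longlongrightarrow> B') (at_left b)"
    and w': "Re w \<noteq> 0"
  shows mellin_const_conv: "mellin_conv (einterval a b) (\<lambda>_. 1) w"
    and mellin_const: "mellin (einterval a b) (\<lambda>_. 1) w = B - A"
proof -
  have sub: "einterval a b \<subseteq> {0<..}"
  proof
    fix x assume "x \<in> einterval a b"
    hence "0 < ereal x" using a(1) order.strict_trans1[of 0 a "ereal x"] by (simp add: einterval_def)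
    thus "x \<in> {0<..}" by simp
  qed
  have pos: "x > 0" if "a < ereal x" "ereal x < b" for x
    using sub that by (auto simp: einterval_def)
  have "set_integrable lborel (einterval a b) (\<lambda>x. x powr (Re w - 1))"
  proof (rule interval_integral_FTC_nonneg(1)[where F = "\<lambda>x. x powr Re w / Re w"])
    show "((\<lambda>x. x powr Re w / Re w) has_real_derivative x powr (Re w - 1)) (at x)" if "a < ereal x" "ereal x < b" for x
      using pos[OF that] w' by (auto intro!: derivative_eq_intros)
  qed (use a A' B' pos in \<open>auto intro!: continuous_intros simp: less_imp_neq[THEN not_sym]\<close>)
  hence "set_integrable lborel (einterval a b) (\<lambda>x. complex_of_real (x powr (Re w - 1)))"
    unfolding set_integrable_def by (simp add: scaleR_conv_of_real complex_of_real_integrable_eq flip: of_real_mult)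
  hence "mellin_conv (einterval a b) (\<lambda>_. 1) (of_real (Re w))"
    unfolding mellin_conv_def
    by (rule set_integrable_cong[THEN iffD1, OF refl refl, rotated])
       (use sub in \<open>auto simp: powr_of_real [symmetric]\<close>)
  thus conv: "mellin_conv (einterval a b) (\<lambda>_. 1) w"
    by (rule mellin_conv_bound) (use sub in \<open>auto simp: set_borel_measurable_def\<close>)
  have "(LBINT x=a..b. complex_of_real x powr (w - 1)) = B - A"
  proof (rule interval_integral_FTC_integrable[where F = "\<lambda>x. of_real x powr w / w"])
    fix x assume x: "a < ereal x" "ereal x < b"
    have "((\<lambda>z. z powr w / w) has_field_derivative of_real x powr (w - 1)) (at (complex_of_real x))"
      using w pos[OF x] by (auto intro!: derivative_eq_intros)
    thus "((\<lambda>x. of_real x powr w / w) has_vector_derivative of_real x powr (w - 1)) (at x)"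
      by (rule has_vector_derivative_real_field)
    show "isCont (\<lambda>x. complex_of_real x powr (w - 1)) x"
      using pos[OF x] by (auto intro!: continuous_intros)
  qed (use a A B conv in \<open>auto simp: mellin_conv_def\<close>)
  thus "mellin (einterval a b) (\<lambda>_. 1) w = B - A"
    using a by (simp add: interval_lebesgue_integral_def mellin_def less_imp_le)
qed

lemma mellin_const_0_1:
  assumes "Re w > 0"
  shows "mellin_conv {0<..<1} (\<lambda>_. 1) w" "mellin {0<..<1} (\<lambda>_. 1) w = 1 / w"
proof -
  have ei: "einterval (ereal 0) (ereal 1) = {0<..<1}" by (auto simp: einterval_def)
  have w: "w \<noteq> 0" "Re w \<noteq> 0" using assms by auto
  have r0: "((\<lambda>x. x powr Re w) \<longlongrightarrow> 0) (at_right 0)"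
    using assms by (auto intro!: tendsto_eq_intros simp: eventually_at_filter)
  have c0: "((\<lambda>x. complex_of_real x powr w) \<longlongrightarrow> 0) (at_right 0)"
  proof (rule tendsto_norm_zero_cancel, rule Lim_transform_eventually[OF r0])
    show "\<forall>\<^sub>F x in at_right 0. x powr Re w = norm (complex_of_real x powr w)"
      by (auto simp: eventually_at_filter norm_powr_real_powr)
  qed
  have "((\<lambda>x. complex_of_real x powr w / w) \<longlongrightarrow> 0) (at_right 0)"
    "((\<lambda>x. x powr Re w / Re w) \<longlongrightarrow> 0) (at_right 0)"
    using tendsto_divide[OF c0 tendsto_const w(1)] tendsto_divide[OF r0 tendsto_const w(2)] by simp_all
  moreover have "isCont (\<lambda>x. complex_of_real x powr w / w) 1" "isCont (\<lambda>x. x powr Re w / Re w) 1"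
    using w by (auto intro!: continuous_intros)
  hence "((\<lambda>x. complex_of_real x powr w / w) \<longlongrightarrow> 1 / w) (at_left 1)"
    "((\<lambda>x. x powr Re w / Re w) \<longlongrightarrow> 1 / Re w) (at_left 1)"
    by (simp_all add: isCont_def filterlim_at_split)
  ultimately have lims: "(((\<lambda>x. of_real x powr w / w) \<circ> real_of_ereal) \<longlongrightarrow> 0) (at_right (ereal 0))"
    "(((\<lambda>x. of_real x powr w / w) \<circ> real_of_ereal) \<longlongrightarrow> 1 / w) (at_left (ereal 1))"
    "(((\<lambda>x. x powr Re w / Re w) \<circ> real_of_ereal) \<longlongrightarrow> 0) (at_right (ereal 0))"
    "(((\<lambda>x. x powr Re w / Re w) \<circ> real_of_ereal) \<longlongrightarrow> 1 / Re w) (at_left (ereal 1))"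
    by (simp_all only: ereal_tendsto_simps)
  show "mellin_conv {0<..<1} (\<lambda>_. 1) w" "mellin {0<..<1} (\<lambda>_. 1) w = 1 / w"
    using mellin_const_conv[OF _ _ w(1) lims w(2)] mellin_const[OF _ _ w(1) lims w(2)]
    unfolding ei by auto
qed

lemma mellin_const_1_inf:
  assumes "Re w < 0"
  shows "mellin_conv {1<..} (\<lambda>_. 1) w" "mellin {1<..} (\<lambda>_. 1) w = - 1 / w"
proof -
  have ei: "einterval (ereal 1) \<infinity> = {1<..}" by (auto simp: einterval_def)
  have w: "w \<noteq> 0" "Re w \<noteq> 0" using assms by auto
  have r0: "((\<lambda>x. x powr Re w) \<longlongrightarrow> 0) at_top"
    using assms by (intro tendsto_neg_powr filterlim_ident)
  have c0: "((\<lambda>x. complex_of_real x powr w) \<longlongrightarrow> 0) at_top"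
  proof (rule tendsto_norm_zero_cancel, rule Lim_transform_eventually[OF r0])
    show "\<forall>\<^sub>F x in at_top. x powr Re w = norm (complex_of_real x powr w)"
      using eventually_gt_at_top[of 0] by eventually_elim (auto simp: norm_powr_real_powr)
  qed
  have "((\<lambda>x. complex_of_real x powr w / w) \<longlongrightarrow> 0) at_top"
    "((\<lambda>x. x powr Re w / Re w) \<longlongrightarrow> 0) at_top"
    using tendsto_divide[OF c0 tendsto_const w(1)] tendsto_divide[OF r0 tendsto_const w(2)] by simp_all
  moreover have "isCont (\<lambda>x. complex_of_real x powr w / w) 1" "isCont (\<lambda>x. x powr Re w / Re w) 1"
    using w by (auto intro!: continuous_intros)
  hence "((\<lambda>x. complex_of_real x powr w / w) \<longlongrightarrow> 1 / w) (at_right 1)"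
    "((\<lambda>x. x powr Re w / Re w) \<longlongrightarrow> 1 / Re w) (at_right 1)"
    by (simp_all add: isCont_def filterlim_at_split)
  ultimately have lims: "(((\<lambda>x. of_real x powr w / w) \<circ> real_of_ereal) \<longlongrightarrow> 1 / w) (at_right (ereal 1))"
    "(((\<lambda>x. of_real x powr w / w) \<circ> real_of_ereal) \<longlongrightarrow> 0) (at_left \<infinity>)"
    "(((\<lambda>x. x powr Re w / Re w) \<circ> real_of_ereal) \<longlongrightarrow> 1 / Re w) (at_right (ereal 1))"
    "(((\<lambda>x. x powr Re w / Re w) \<circ> real_of_ereal) \<longlongrightarrow> 0) (at_left \<infinity>)"
    by (simp_all only: ereal_tendsto_simps)
  show "mellin_conv {1<..} (\<lambda>_. 1) w" "mellin {1<..} (\<lambda>_. 1) w = - 1 / w"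
    using mellin_const_conv[OF _ _ w(1) lims w(2)] mellin_const[OF _ _ w(1) lims w(2)]
    unfolding ei by auto
qed

lemma mellin_Icc_holomorphic:
  assumes a: "0 < a" and h: "continuous_on {0<..} h" and U: "convex U"
  shows "mellin {a..b} h holomorphic_on U"
proof -
  have cont: "continuous_on {a..b} (\<lambda>t. complex_of_real t powr (s - 1) * h t)" for s
    using a by (auto intro!: continuous_intros continuous_on_subset[OF h])
  have eq: "mellin {a..b} h = (\<lambda>s. integral (cbox a b) (\<lambda>t. complex_of_real t powr (s - 1) * h t))"
  proof
    fix s
    have "set_integrable lborel {a..b} (\<lambda>t. complex_of_real t powr (s - 1) * h t)"
      by (rule borel_integrable_atLeastAtMost') (rule cont)
    from set_borel_integral_eq_integral(2)[OF this]
    show "mellin {a..b} h s = integral (cbox a b) (\<lambda>t. complex_of_real t powr (s - 1) * h t)"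
      by (simp add: mellin_def)
  qed
  show ?thesis
    unfolding eq
  proof (rule leibniz_rule_holomorphic[OF _ _ _ U])
    fix s t assume t: "t \<in> cbox a b"
    hence "complex_of_real t \<noteq> 0" using a by auto
    thus "((\<lambda>s. complex_of_real t powr (s - 1) * h t) has_field_derivative
            Ln (of_real t) * of_real t powr (s - 1) * h t) (at s within U)"
      by (auto simp: powr_def intro!: derivative_eq_intros)
  next
    fix s show "(\<lambda>t. complex_of_real t powr (s - 1) * h t) integrable_on cbox a b"
      using cont[of s] by (auto intro: integrable_continuous_interval)
  next
    have "continuous_on (U \<times> cbox a b) (\<lambda>p. h (snd p))"
      using a by (intro continuous_on_compose2[OF h]) (auto intro!: continuous_intros)
    thus "continuous_on (U \<times> cbox a b) (\<lambda>(s, t). Ln (complex_of_real t) * of_real t powr (s - 1) * h t)"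
      unfolding case_prod_unfold using a by (intro continuous_intros) auto
  qed
qed

text \<open>A majorant uniform in d between c and e, valid near 0 and at infinity alike; it
  dominates a whole disc of exponents at once.\<close>

lemma powr_le_sum_ends:
  assumes "x > 0" "c \<le> d" "d \<le> e"
  shows "x powr d \<le> x powr c + x powr (e::real)"
proof (cases "x \<ge> 1")
  case True
  hence "x powr d \<le> x powr e" using assms by (intro powr_mono) auto
  thus ?thesis using powr_ge_zero[of x c] by linarith
next
  case False
  hence "x powr d \<le> x powr c" using assms by (intro powr_mono') auto
  thus ?thesis using powr_ge_zero[of x e] by linarith
qed

text \<open>The transforms over compact intervals are holomorphic and converge locally uniformly: on
  a disc the error is at most the integral of \<open>D\<close> over the part of S not yet
  covered.\<close>

lemma mellin_holomorphic:
  fixes a b :: "nat \<Rightarrow> real"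
  assumes S: "S = (\<Union>n. {a n..b n})" "decseq a" "incseq b" "\<And>n. a n > 0"
    and h: "continuous_on {0<..} h"
    and conv: "\<And>s. c < Re s \<Longrightarrow> mellin_conv S h s"
  shows "mellin S h holomorphic_on {s. c < Re s}"
proof (rule holomorphic_uniform_sequence)
  show "open {s. c < Re s}" by (rule open_halfspace_Re_gt)
  show "mellin {a n..b n} h holomorphic_on {s. c < Re s}" for n
    by (rule mellin_Icc_holomorphic[OF S(4) h]) (rule convex_halfspace_Re_gt)
  fix s0 assume "s0 \<in> {s. c < Re s}"
  hence s0: "c < Re s0" by simp
  \<comment> \<open>Half the distance to the boundary line, so that both exponents Re s0 - d and Re
    s0 + d in the majorant stay in the region of convergence.\<close>
  define d where "d = (Re s0 - c) / 2"
  have d: "d > 0" "c < Re s0 - d" using s0 by (auto simp: d_def field_simps)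
  have inc: "incseq (\<lambda>n. {a n..b n})"
    using S(2,3) by (force simp: incseq_def decseq_def intro: order_trans)
  have pos: "x > 0" if "x \<in> S" for x
    using that S(1) S(4) by (force intro: less_le_trans)
  define D where "D = (\<lambda>x. norm (complex_of_real x powr (of_real (Re s0 - d) - 1) * h x) +
      norm (complex_of_real x powr (of_real (Re s0 + d) - 1) * h x))"
  have D: "set_integrable lborel S D"
    unfolding D_def
    by (intro set_integral_add set_integrable_norm conv[unfolded mellin_conv_def]) (use d in auto)
  have lim: "(\<lambda>n. LINT x:{a n..b n}|lborel. D x) \<longlonglongrightarrow> (LINT x:S|lborel. D x)"
    unfolding S(1) by (rule set_integral_cont_up) (use inc D S(1) in auto)
  have bound: "norm (mellin S h s - mellin {a n..b n} h s) \<le> (LINT x:S|lborel. D x) - (LINT x:{a n..b n}|lborel. D x)"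
    if s: "s \<in> cball s0 d" for s n
  proof -
    have "\<bar>Re s - Re s0\<bar> \<le> d"
      using abs_Re_le_cmod[of "s - s0"] s by (simp add: dist_norm norm_minus_commute)
    hence Re_s: "Re s0 - d \<le> Re s" "Re s \<le> Re s0 + d" by linarith+
    have sub: "{a n..b n} \<subseteq> S" using S(1) by auto
    let ?F = "\<lambda>x. complex_of_real x powr (s - 1) * h x"
    have i1: "set_integrable lborel S ?F"
      using conv[of s] d Re_s by (simp add: mellin_conv_def)
    have i2: "set_integrable lborel {a n..b n} ?F" by (rule set_integrable_subset[OF i1]) (use sub in auto)
    have i3: "set_integrable lborel {a n..b n} D" by (rule set_integrable_subset[OF D]) (use sub in auto)
    have "mellin S h s - mellin {a n..b n} h s =
       (\<integral>x. indicator S x *\<^sub>R ?F x - indicator {a n..b n} x *\<^sub>R ?F x \<partial>lborel)"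
      using i1 i2 unfolding mellin_def set_lebesgue_integral_def set_integrable_def
      by (rule Bochner_Integration.integral_diff [symmetric])
    also have "norm \<dots> \<le> (\<integral>x. indicator S x *\<^sub>R D x - indicator {a n..b n} x *\<^sub>R D x \<partial>lborel)"
    proof (rule order.trans[OF integral_norm_bound integral_mono])
      show "integrable lborel (\<lambda>x. norm (indicator S x *\<^sub>R ?F x - indicator {a n..b n} x *\<^sub>R ?F x))"
        using i1 i2 unfolding set_integrable_def by (intro integrable_norm Bochner_Integration.integrable_diff)
      show "integrable lborel (\<lambda>x. indicator S x *\<^sub>R D x - indicator {a n..b n} x *\<^sub>R D x)"
        using D i3 unfolding set_integrable_def by (rule Bochner_Integration.integrable_diff)
      fix x
      have "norm (?F x) \<le> D x" if "x \<in> S"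
      proof -
        have x: "x > 0" using pos that by auto
        have "norm (?F x) = x powr (Re s - 1) * norm (h x)" using x by (simp add: norm_mult norm_powr_real_powr)
        also have "\<dots> \<le> (x powr (Re s0 - d - 1) + x powr (Re s0 + d - 1)) * norm (h x)"
          by (intro mult_right_mono powr_le_sum_ends) (use x Re_s in auto)
        also have "\<dots> = D x"
          using x by (simp add: D_def norm_mult norm_powr_real_powr distrib_right)
        finally show ?thesis .
      qed
      thus "norm (indicator S x *\<^sub>R ?F x - indicator {a n..b n} x *\<^sub>R ?F x)
           \<le> indicator S x *\<^sub>R D x - indicator {a n..b n} x *\<^sub>R D x"
        using sub by (cases "x \<in> S"; cases "x \<in> {a n..b n}") auto
    qed
    also have "\<dots> = (LINT x:S|lborel. D x) - (LINT x:{a n..b n}|lborel. D x)"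
      using D i3 unfolding set_lebesgue_integral_def set_integrable_def
      by (rule Bochner_Integration.integral_diff)
    finally show ?thesis .
  qed
  have "uniform_limit (cball s0 d) (\<lambda>n. mellin {a n..b n} h) (mellin S h) sequentially"
  proof (rule uniform_limitI)
    fix e :: real assume "e > 0"
    with lim have "\<forall>\<^sub>F n in sequentially. dist (LINT x:{a n..b n}|lborel. D x) (LINT x:S|lborel. D x) < e"
      by (rule tendstoD)
    thus "\<forall>\<^sub>F n in sequentially. \<forall>s\<in>cball s0 d. dist (mellin {a n..b n} h s) (mellin S h s) < e"
    proof eventually_elim
      case (elim n)
      show ?case
      proof
        fix s assume "s \<in> cball s0 d"
        from bound[OF this, of n] elim show "dist (mellin {a n..b n} h s) (mellin S h s) < e"
          by (simp add: dist_norm norm_minus_commute)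
      qed
    qed
  qed
  moreover have "cball s0 d \<subseteq> {s. c < Re s}"
  proof
    fix s assume "s \<in> cball s0 d"
    hence "\<bar>Re s - Re s0\<bar> \<le> d"
      using abs_Re_le_cmod[of "s - s0"] by (simp add: dist_norm norm_minus_commute)
    thus "s \<in> {s. c < Re s}" using d by auto
  qed
  ultimately show "\<exists>d>0. cball s0 d \<subseteq> {s. c < Re s} \<and>
      uniform_limit (cball s0 d) (\<lambda>n. mellin {a n..b n} h) (mellin S h) sequentially"
    using d by blast
qed

lemma mellin_affine:
  assumes S: "S \<in> sets borel" "S \<subseteq> {0<..}"
    and eq: "\<And>x. x \<in> S \<Longrightarrow> g x = A / of_real x + B + r x"
    and "mellin_conv S (\<lambda>_. 1) (s - 1)" "mellin_conv S (\<lambda>_. 1) s" "mellin_conv S r s"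
  shows "mellin S g s = A * mellin S (\<lambda>_. 1) (s - 1) + B * mellin S (\<lambda>_. 1) s + mellin S r s"
proof -
  have i: "set_integrable lborel S (\<lambda>x. A * (complex_of_real x powr (s - 1 - 1) * 1))"
    "set_integrable lborel S (\<lambda>x. B * (complex_of_real x powr (s - 1) * 1))"
    "set_integrable lborel S (\<lambda>x. complex_of_real x powr (s - 1) * r x)"
    using assms(4-6) unfolding mellin_conv_def by (auto intro!: set_integrable_mult_right)
  have "mellin S g s = (LINT x:S|lborel. (A * (complex_of_real x powr (s - 1 - 1) * 1) +
      B * (complex_of_real x powr (s - 1) * 1)) + complex_of_real x powr (s - 1) * r x)"
    unfolding mellin_def
  proof (rule set_lebesgue_integral_cong)
    show "\<forall>x. x \<in> S \<longrightarrow> complex_of_real x powr (s - 1) * g x = (A * (complex_of_real x powr (s - 1 - 1) * 1) +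
      B * (complex_of_real x powr (s - 1) * 1)) + complex_of_real x powr (s - 1) * r x"
    proof (intro allI impI)
      fix x assume x: "x \<in> S"
      hence "x > 0" using S by auto
      hence "complex_of_real x powr (s - 1 - 1) = complex_of_real x powr (s - 1) / of_real x"
        by (subst powr_diff) auto
      thus "complex_of_real x powr (s - 1) * g x = (A * (complex_of_real x powr (s - 1 - 1) * 1) +
      B * (complex_of_real x powr (s - 1) * 1)) + complex_of_real x powr (s - 1) * r x"
        by (simp add: eq[OF x] distrib_left distrib_right mult_ac)
    qed
  qed (use S in simp)
  also have "\<dots> = (LINT x:S|lborel. A * (complex_of_real x powr (s - 1 - 1) * 1)) +
      (LINT x:S|lborel. B * (complex_of_real x powr (s - 1) * 1)) + mellin S r s"
    unfolding mellin_def
    by (subst set_integral_add(2)[OF set_integral_add(1)[OF i(1,2)] i(3)], subst set_integral_add(2)[OF i(1,2)]) simp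
  also have "(LINT x:S|lborel. A * (complex_of_real x powr (s - 1 - 1) * 1)) = A * mellin S (\<lambda>_. 1) (s - 1)"
    unfolding mellin_def by (rule set_integral_mult_right)
  also have "(LINT x:S|lborel. B * (complex_of_real x powr (s - 1) * 1)) = B * mellin S (\<lambda>_. 1) s"
    unfolding mellin_def by (rule set_integral_mult_right)
  finally show ?thesis .
qed

text \<open>Against x powr (s - 1), the function A/x + B integrates to A/(s - 1) + B/s over (0, 1)
  if Re s > 1, and to the negative of this over (1, \<infinity>) if Re s < 0. Hence replacing g by r
  on (0, 1), or r by g on (1, \<infinity>), leads to the same formula with the same
  \<open>H\<close>.\<close>

lemma mellin_continuation:
  assumes g: "continuous_on {0<..} g" and r: "continuous_on {0<..} r"
    and eq: "\<And>x. x > 0 \<Longrightarrow> g x = A / of_real x + B + r x"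
    and r_conv: "\<And>s. -1 < Re s \<Longrightarrow> Re s < 0 \<Longrightarrow> mellin_conv {0<..} r s"
    and g_conv: "\<And>s. 1 < Re s \<Longrightarrow> mellin_conv {0<..} g s"
  obtains H where "H holomorphic_on {s. -1 < Re s}"
    and "\<And>s. 1 < Re s \<Longrightarrow> mellin {0<..} g s = H s + A / (s - 1) + B / s"
    and "\<And>s. -1 < Re s \<Longrightarrow> Re s < 0 \<Longrightarrow> mellin {0<..} r s = H s + A / (s - 1) + B / s"
proof -
  define H where "H = (\<lambda>s. mellin {0<..<1} r s + mellin {1<..} g s)"
  have meas: "set_borel_measurable borel S f" if "continuous_on {0<..} f" "S \<subseteq> {0<..}" "S \<in> sets borel"
    for f :: "real \<Rightarrow> complex" and S
    unfolding set_borel_measurable_def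
    by (rule borel_measurable_continuous_on_indicator) (use that in \<open>auto intro: continuous_on_subset\<close>)
  have r0: "mellin_conv {0<..<1} r s" if "-1 < Re s" for s
  proof (rule mellin_conv_mono)
    \<comment> \<open>On (0, 1) convergence persists when the real part grows, so a point of the
      strip not to the right of s is enough; -1/2 keeps it below 0.\<close>
    show "mellin_conv {0<..<1} r (of_real (min (Re s) (-1/2)))"
      by (rule mellin_conv_subset[OF r_conv]) (use that in auto)
    show "set_borel_measurable borel {0<..<1} r" by (rule meas[OF r]) auto
  qed (auto intro!: powr_mono')
  have g1: "mellin_conv {1<..} g s" for s
  proof (rule mellin_conv_mono)
    \<comment> \<open>On (1, \<infinity>) convergence persists when the real part shrinks; 2 is any
      real number above 1.\<close>
    show "mellin_conv {1<..} g (of_real (max (Re s) 2))"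
      by (rule mellin_conv_subset[OF g_conv]) auto
    show "set_borel_measurable borel {1<..} g" by (rule meas[OF g]) auto
  qed (auto intro!: powr_mono)
  have "mellin {0<..<1} r holomorphic_on {s. -1 < Re s}"
  proof (rule mellin_holomorphic[OF _ _ _ _ r r0])
    show "{0<..<1} = (\<Union>n. {1 / real (n + 2)..1 - 1 / real (n + 2)})"
    proof (intro equalityI subsetI)
      fix x :: real assume x: "x \<in> {0<..<1}"
      obtain n where n: "1 / real (Suc n) < min x (1 - x)"
        using nat_approx_posE[of "min x (1 - x)"] x by auto
      have "1 / real (n + 2) \<le> 1 / real (Suc n)" by (simp add: field_simps)
      hence "x \<in> {1 / real (n + 2)..1 - 1 / real (n + 2)}" using n by auto
      thus "x \<in> (\<Union>n. {1 / real (n + 2)..1 - 1 / real (n + 2)})" by blast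
    next
      fix x :: real assume "x \<in> (\<Union>n. {1 / real (n + 2)..1 - 1 / real (n + 2)})"
      then obtain n where n: "1 / real (n + 2) \<le> x" "x \<le> 1 - 1 / real (n + 2)" by auto
      moreover have "1 / real (n + 2) > 0" by simp
      ultimately show "x \<in> {0<..<1}" unfolding greaterThanLessThan_iff by linarith
    qed
  qed (auto simp: decseq_def incseq_def field_simps)
  moreover have "mellin {1<..} g holomorphic_on {s. -1 < Re s}"
  proof (rule mellin_holomorphic[OF _ _ _ _ g g1])
    show "{1<..} = (\<Union>n. {1 + 1 / real (n + 1)..real n})"
    proof (intro equalityI subsetI)
      fix x :: real assume x: "x \<in> {1<..}"
      obtain n where n: "1 / real (Suc n) < x - 1"
        using nat_approx_posE[of "x - 1"] x by auto
      obtain m where m: "x \<le> real m" using real_arch_simple by auto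
      have "1 / real (max n m + 1) \<le> 1 / real (Suc n)" by (simp add: field_simps)
      hence "x \<in> {1 + 1 / real (max n m + 1)..real (max n m)}" using n m by auto
      thus "x \<in> (\<Union>n. {1 + 1 / real (n + 1)..real n})" by blast
    next
      fix x :: real assume "x \<in> (\<Union>n. {1 + 1 / real (n + 1)..real n})"
      then obtain n where n: "1 + 1 / real (n + 1) \<le> x" by auto
      moreover have "1 / real (n + 1) > 0" by simp
      ultimately show "x \<in> {1<..}" unfolding greaterThan_iff by linarith
    qed
  qed (auto simp: decseq_def incseq_def field_simps add_pos_pos)
  ultimately have 1: "H holomorphic_on {s. -1 < Re s}"
    unfolding H_def by (intro holomorphic_intros)
  have 2: "mellin {0<..} g s = H s + A / (s - 1) + B / s" if s: "1 < Re s" for s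
  proof -
    have "mellin {0<..<1} g s = A * mellin {0<..<1} (\<lambda>_. 1) (s - 1) + B * mellin {0<..<1} (\<lambda>_. 1) s + mellin {0<..<1} r s"
      by (rule mellin_affine) (use s eq in \<open>auto intro!: mellin_const_0_1 r0\<close>)
    also have "mellin {0<..<1} (\<lambda>_. 1) (s - 1) = 1 / (s - 1)" using s by (intro mellin_const_0_1) auto
    also have "mellin {0<..<1} (\<lambda>_. 1) s = 1 / s" using s by (intro mellin_const_0_1) auto
    finally show ?thesis using mellin_split_at_1[OF g_conv[OF s]] by (simp add: H_def)
  qed
  have 3: "mellin {0<..} r s = H s + A / (s - 1) + B / s" if s: "-1 < Re s" "Re s < 0" for s
  proof -
    have "mellin {1<..} g s = A * mellin {1<..} (\<lambda>_. 1) (s - 1) + B * mellin {1<..} (\<lambda>_. 1) s + mellin {1<..} r s"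
      by (rule mellin_affine)
         (use s eq in \<open>auto intro!: mellin_const_1_inf mellin_conv_subset[OF r_conv]\<close>)
    also have "mellin {1<..} (\<lambda>_. 1) (s - 1) = - 1 / (s - 1)" using s by (intro mellin_const_1_inf) auto
    also have "mellin {1<..} (\<lambda>_. 1) s = - 1 / s" using s by (intro mellin_const_1_inf) auto
    finally show ?thesis using mellin_split_at_1[OF r_conv[OF s]] by (simp add: H_def)
  qed
  show ?thesis by (rule that[OF 1 2 3])
qed

section \<open>Periodic zeta functions\<close>

text \<open>The representative lies in \<open>{1..k}\<close>, so the zero class is represented by \<open>k\<close>; this keeps
  the Hurwitz parameter \<open>residue_rep k c / k\<close> in \<open>(0, 1]\<close>.\<close>

definition residue_rep :: "nat \<Rightarrow> int \<Rightarrow> nat" where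
  "residue_rep k c = (if int k dvd c then k else nat (c mod int k))"

lemma residue_rep_pos: "k > 0 \<Longrightarrow> residue_rep k c > 0"
  by (auto simp: residue_rep_def dvd_eq_mod_eq_0 intro: le_neq_trans)

lemma residue_rep_minus:
  assumes "k > 0" "\<not> int k dvd c"
  shows "real (residue_rep k (-c)) = real k - real (residue_rep k c)"
proof -
  have "c mod int k \<noteq> 0" using assms(2) by (simp add: dvd_eq_mod_eq_0)
  hence "(-c) mod int k = int k - c mod int k" by (simp add: zmod_zminus1_eq_if)
  moreover have "0 \<le> c mod int k" "c mod int k < int k" using assms(1) by auto
  ultimately show ?thesis using assms(2) by (simp add: residue_rep_def)
qed

section \<open>Cotangent, Digamma and the geometric series\<close>

text \<open>Logarithmic derivative of Gamma z * Gamma (1 - z) = pi / sin (pi z): both sides are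
  differentiated at z and the nonzero product is cancelled.\<close>

lemma cot_eq_Digamma_diff:
  assumes "z \<notin> \<int>"
  shows "of_real pi * (cos (of_real pi * z) / sin (of_real pi * z)) = Digamma (1 - z) - Digamma (z :: complex)"
proof -
  have s: "sin (of_real pi * z) \<noteq> 0"
  proof
    assume "sin (of_real pi * z) = 0"
    then obtain n :: int where "of_real pi * z = of_real (of_int n * pi)"
      unfolding sin_eq_0 by blast
    hence "z = of_int n" by simp
    thus False using assms by auto
  qed
  have z: "z \<notin> \<int>\<^sub>\<le>\<^sub>0" "1 - z \<notin> \<int>\<^sub>\<le>\<^sub>0"
    using assms by (metis nonpos_Ints_Int, metis Ints_1 Ints_diff diff_diff_eq2 add_diff_cancel_left' nonpos_Ints_Int)
  have 1: "((\<lambda>w. Gamma w * Gamma (1 - w)) has_field_derivative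
       Gamma z * Gamma (1 - z) * (Digamma z - Digamma (1 - z))) (at z)"
    using z by (auto intro!: derivative_eq_intros simp: algebra_simps)
  have "((\<lambda>w. of_real pi / sin (of_real pi * w)) has_field_derivative
       - (of_real pi / sin (of_real pi * z) * (of_real pi * (cos (of_real pi * z) / sin (of_real pi * z))))) (at z)"
    using s by (auto intro!: derivative_eq_intros)
  hence "Gamma z * Gamma (1 - z) * (Digamma z - Digamma (1 - z)) =
      - (Gamma z * Gamma (1 - z) * (of_real pi * (cos (of_real pi * z) / sin (of_real pi * z))))"
    using DERIV_unique[OF 1] by (simp only: Gamma_reflection_complex)
  moreover have "Gamma z * Gamma (1 - z) \<noteq> 0" using s by (simp only: Gamma_reflection_complex) simp
  ultimately have "Digamma z - Digamma (1 - z) = - (of_real pi * (cos (of_real pi * z) / sin (of_real pi * z)))"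
    by (metis mult_left_cancel mult_minus_right)
  thus ?thesis by (simp add: algebra_simps)
qed

text \<open>With q = e(z), q/(1 - q) = -1/2 + (1/2)(1 + q)/(1 - q), and (1 + q)/(1 - q) is i times
  the cotangent of pi z.\<close>

lemma geometric_eq_Digamma_diff:
  assumes "z \<notin> \<int>"
  shows "exp (2 * of_real pi * \<i> * z) / (1 - exp (2 * of_real pi * \<i> * z)) =
     \<i> / (2 * of_real pi) * (Digamma (1 - z) - Digamma z) - 1 / 2"
proof -
  define E where "E = exp (\<i> * (of_real pi * z))"
  define q where "q = exp (2 * of_real pi * \<i> * z)"
  have E: "E \<noteq> 0" "E ^ 2 = q"
    unfolding E_def q_def by (simp_all add: exp_double [symmetric] mult_ac)
  have q1: "1 - q \<noteq> 0"
  proof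
    assume "1 - q = 0"
    then obtain n :: int where "2 * of_real pi * \<i> * z = of_real (of_int (2 * n) * pi) * \<i>"
      unfolding q_def using exp_eq_1[of "2 * of_real pi * \<i> * z"]
      by (auto simp: complex_eq_iff)
    hence "z = of_int n" by (auto simp: complex_eq_iff)
    thus False using assms by auto
  qed
  have c: "cos (of_real pi * z) = (q + 1) / (2 * E)"
    using E unfolding cos_exp_eq E_def [symmetric] exp_minus
    by (simp add: field_simps power2_eq_square)
  have s: "sin (of_real pi * z) = (q - 1) / (2 * \<i> * E)"
    using E unfolding sin_exp_eq E_def [symmetric] exp_minus
    by (simp add: field_simps power2_eq_square)
  have "\<i> / (2 * of_real pi) * (Digamma (1 - z) - Digamma z) =
      \<i> / 2 * (cos (of_real pi * z) / sin (of_real pi * z))"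
    unfolding cot_eq_Digamma_diff[OF assms, symmetric] by simp
  also have "cos (of_real pi * z) / sin (of_real pi * z) = \<i> * (q + 1) / (q - 1)"
    unfolding c s using E q1 by (simp add: field_simps)
  finally have T: "\<i> / (2 * of_real pi) * (Digamma (1 - z) - Digamma z) = \<i> / 2 * (\<i> * (q + 1) / (q - 1))" .
  have "q - 1 \<noteq> 0" using q1 by auto
  thus ?thesis unfolding q_def [symmetric] T using q1
    by (simp add: divide_simps) (simp add: algebra_simps)?
qed

definition root_geom :: "nat \<Rightarrow> int \<Rightarrow> real \<Rightarrow> complex" where
  "root_geom k c x = e_fun (of_int c / of_nat k) * exp (- of_real x) /
      (1 - e_fun (of_int c / of_nat k) * exp (- of_real x))"

text \<open>If k does not divide c, this is i/(2 pi) times Digamma (1 - z) - Digamma z at z =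
  \<open>residue_rep k c / k\<close> + i x/(2 pi), each term diminished by its value at x = 0 so
  that the result is O(x) there. The factors -1 and 1 and the argument 1/(2 pi) * x are written out
  to fit \<open>mellin_Digamma\<close> and \<open>mellin_scale\<close>.\<close>

definition root_rem :: "nat \<Rightarrow> int \<Rightarrow> real \<Rightarrow> complex" where
  "root_rem k c x = \<i> / (2 * of_real pi) *
     ((Digamma (of_real (residue_rep k (-c) / k) + \<i> * (-1) * of_real (1 / (2 * pi) * x)) -
       Digamma (of_real (residue_rep k (-c) / k))) -
      (Digamma (of_real (residue_rep k c / k) + \<i> * 1 * of_real (1 / (2 * pi) * x)) -
       Digamma (of_real (residue_rep k c / k))))"

lemma e_fun_add: "e_fun (a + b) = e_fun a * e_fun b"
  by (simp add: e_fun_def distrib_left exp_add)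

lemma e_fun_of_int: "e_fun (of_int n) = 1"
  by (auto simp: exp_eq_1 e_fun_def intro!: exI[of _ n])

lemma norm_e_fun_of_real: "norm (e_fun (of_real x)) = 1"
  by (simp add: e_fun_def)

lemma norm_e_fun_rational: "norm (e_fun (of_int c / of_nat k)) = 1"
  using norm_e_fun_of_real[of "of_int c / of_nat k"] by simp

lemma e_fun_cong:
  assumes "k > 0" "[a = b] (mod int k)"
  shows "e_fun (of_int a / of_nat k) = e_fun (of_int b / of_nat k)"
proof -
  obtain m where "a = b + int k * m"
    using assms(2) by (metis cong_iff_lin cong_sym)
  hence "(of_int a / of_nat k :: complex) = of_int b / of_nat k + of_int m"
    using assms(1) by (simp add: field_simps)
  thus ?thesis by (simp add: e_fun_add e_fun_of_int)
qed

text \<open>The singular part at \<open>0\<close> produces the pole of the periodic zeta function at \<open>1\<close>, and the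
  constant \<open>B\<close> a pole at \<open>0\<close> that \<open>rGamma\<close> cancels.\<close>

lemma root_geom_expansion:
  assumes k: "k > 0"
  obtains B where "\<And>x. x > 0 \<Longrightarrow>
     root_geom k c x = (if int k dvd c then 1 else 0) / of_real x + B + root_rem k c x"
proof -
  define \<alpha> where "\<alpha> = residue_rep k c / k"
  define \<beta> where "\<beta> = residue_rep k (-c) / k"
  define B where "B = \<i> / (2 * of_real pi) * (Digamma (of_real \<beta>) - Digamma (of_real \<alpha>)) - 1 / 2"
  have "root_geom k c x = (if int k dvd c then 1 else 0) / of_real x + B + root_rem k c x"
    if x: "x > 0" for x
  proof -
    define X where "X = 1 / (2 * pi) * x"
    have X: "X > 0" using x by (simp add: X_def)
    have notint: "of_real y + \<i> * of_real X \<notin> \<int>" for y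
    proof
      assume "of_real y + \<i> * of_real X \<in> \<int>"
      then obtain n where "of_real y + \<i> * of_real X = of_int n" by (auto elim!: Ints_cases)
      from arg_cong[OF this, of Im] show False using X by simp
    qed
    \<comment> \<open>Any real y with e(y) = e(c/k) may be used: \<alpha> for a nonzero class, 0 for
      the zero class. The choice X = x/(2 pi) makes e(iX) equal to exp (-x).\<close>
    have geom: "root_geom k c x = \<i> / (2 * of_real pi) *
        (Digamma (1 - (of_real y + \<i> * of_real X)) - Digamma (of_real y + \<i> * of_real X)) - 1 / 2"
      if "e_fun (of_int c / of_nat k) = e_fun (of_real y)" for y
    proof -
      have "e_fun (of_int c / of_nat k) * exp (- of_real x) = exp (2 * of_real pi * \<i> * (of_real y + \<i> * of_real X))"
      proof -
        have "2 * of_real pi * \<i> * (of_real y + \<i> * of_real X) = 2 * of_real pi * \<i> * of_real y + - of_real x"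
          by (simp add: X_def distrib_left)
        thus ?thesis unfolding that by (simp only: e_fun_def exp_add)
      qed
      thus ?thesis
        unfolding root_geom_def using geometric_eq_Digamma_diff[OF notint[of y]] by simp
    qed
    have rem: "root_rem k c x + B = \<i> / (2 * of_real pi) *
       (Digamma (of_real \<beta> - \<i> * of_real X) - Digamma (of_real \<alpha> + \<i> * of_real X)) - 1 / 2"
      unfolding root_rem_def B_def \<alpha>_def [symmetric] \<beta>_def [symmetric] X_def [symmetric]
      by (simp add: algebra_simps)
    show ?thesis
    proof (cases "int k dvd c")
      case True
      have ab: "\<alpha> = 1" "\<beta> = 1" using True k by (simp_all add: \<alpha>_def \<beta>_def residue_rep_def)
      have "[c = 0] (mod int k)" using True by (simp add: cong_0_iff)
      from e_fun_cong[OF k this] have "e_fun (of_int c / of_nat k) = e_fun (of_real 0)" by simp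
      note geom[OF this]
      \<comment> \<open>Here z = iX, whereas \<open>root_rem\<close> contains Digamma (1 + iX). The
        recurrence links the two, and its term 1/(iX), multiplied by i/(2 pi), is the singular part
        1/x.\<close>
      moreover have "Digamma (\<i> * of_real X + 1) = Digamma (\<i> * of_real X) + 1 / (\<i> * of_real X)"
        using X by (intro Digamma_plus1) auto
      hence "Digamma (\<i> * of_real X) = Digamma (of_real \<alpha> + \<i> * of_real X) - 1 / (\<i> * of_real X)"
        by (simp add: ab add_ac)
      ultimately have "root_geom k c x = \<i> / (2 * of_real pi) *
         (Digamma (of_real \<beta> - \<i> * of_real X) - Digamma (of_real \<alpha> + \<i> * of_real X)) - 1 / 2
           + \<i> / (2 * of_real pi) * (1 / (\<i> * of_real X))"
        by (simp add: ab algebra_simps)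
      also have "\<i> / (2 * of_real pi) * (1 / (\<i> * of_real X)) = 1 / of_real x"
        using x by (simp add: X_def)
      finally show ?thesis unfolding rem [symmetric] using True by (simp add: add_ac)
    next
      case False
      have ab: "\<beta> = 1 - \<alpha>"
        using residue_rep_minus[OF k False] k by (simp add: \<alpha>_def \<beta>_def field_simps)
      have "int (residue_rep k c) = c mod int k" using False k by (simp add: residue_rep_def)
      hence "[c = int (residue_rep k c)] (mod int k)" by simp
      from e_fun_cong[OF k this] have "e_fun (of_int c / of_nat k) = e_fun (of_real \<alpha>)"
        by (simp add: \<alpha>_def)
      note geom[OF this]
      also have "1 - (of_real \<alpha> + \<i> * of_real X) = of_real \<beta> - \<i> * of_real X"
        by (simp add: ab)
      finally show ?thesis unfolding rem [symmetric] using False by (simp add: add_ac)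
    qed
  qed
  thus ?thesis by (rule that)
qed

text \<open>The two sums are the Hurwitz zeta values at 1 - s for the classes c and -c; the
  rescaling by 1/(2 pi) contributes (2 pi) powr s.\<close>

lemma root_rem_mellin:
  assumes k: "k > 0" and s: "-1 < Re s" "Re s < 0"
  shows "mellin_conv {0<..} (root_rem k c) s"
    and "mellin {0<..} (root_rem k c) s = \<i> / (2 * of_real pi) * of_real (2 * pi) powr s *
      (of_real pi / sin (of_real pi * s)) *
      (exp (- (\<i> * of_real pi * s / 2)) * (\<Sum>n. of_real (residue_rep k c / k + real n) powr (s - 1)) -
       exp (\<i> * of_real pi * s / 2) * (\<Sum>n. of_real (residue_rep k (-c) / k + real n) powr (s - 1)))"
proof -
  define \<alpha> where "\<alpha> = residue_rep k c / k"
  define \<beta> where "\<beta> = residue_rep k (-c) / k"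
  define D where "D = (\<lambda>\<gamma> \<epsilon> x. Digamma (of_real \<gamma> + \<i> * \<epsilon> * of_real x) - Digamma (of_real \<gamma> :: complex))"
  have alg: "a * (P * (- (S * u) * b) - P * (- (S * v) * c)) = a * P * S * (v * c - u * b)"
    for a b c P S u v :: complex
    by (simp add: algebra_simps)
  have pos: "\<alpha> > 0" "\<beta> > 0" using k residue_rep_pos by (simp_all add: \<alpha>_def \<beta>_def)
  have eq: "root_rem k c = (\<lambda>x. \<i> / (2 * of_real pi) * (D \<beta> (-1) (1 / (2 * pi) * x) - D \<alpha> 1 (1 / (2 * pi) * x)))"
    unfolding root_rem_def D_def \<alpha>_def \<beta>_def by (intro ext) (rule refl)
  have c: "mellin_conv {0<..} (\<lambda>x. D \<beta> (-1) (1 / (2 * pi) * x)) s" "mellin_conv {0<..} (\<lambda>x. D \<alpha> 1 (1 / (2 * pi) * x)) s"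
    unfolding D_def by (rule mellin_conv_scale; (rule mellin_Digamma(1))?; use s pos in simp)+
  define f where "f = (\<lambda>\<gamma> \<epsilon> x. complex_of_real x powr (s - 1) * D \<gamma> \<epsilon> (1 / (2 * pi) * x))"
  have i: "set_integrable lborel {0<..} (f \<beta> (-1))" "set_integrable lborel {0<..} (f \<alpha> 1)"
    using c unfolding mellin_conv_def f_def .
  have eq': "complex_of_real x powr (s - 1) * root_rem k c x = \<i> / (2 * of_real pi) * (f \<beta> (-1) x - f \<alpha> 1 x)" for x
    unfolding eq f_def by (simp only: right_diff_distrib mult_ac)
  show "mellin_conv {0<..} (root_rem k c) s"
    unfolding mellin_conv_def eq' by (intro set_integrable_mult_right set_integral_diff(1) i)
  have "mellin {0<..} (root_rem k c) s = \<i> / (2 * of_real pi) *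
      (mellin {0<..} (\<lambda>x. D \<beta> (-1) (1 / (2 * pi) * x)) s - mellin {0<..} (\<lambda>x. D \<alpha> 1 (1 / (2 * pi) * x)) s)"
    unfolding mellin_def eq' set_integral_mult_right set_integral_diff(2)[OF i] unfolding f_def ..
  also have "mellin {0<..} (\<lambda>x. D \<beta> (-1) (1 / (2 * pi) * x)) s = of_real (1 / (2 * pi)) powr (-s) * mellin {0<..} (D \<beta> (-1)) s"
    by (rule mellin_scale) simp
  also have "mellin {0<..} (\<lambda>x. D \<alpha> 1 (1 / (2 * pi) * x)) s = of_real (1 / (2 * pi)) powr (-s) * mellin {0<..} (D \<alpha> 1) s"
    by (rule mellin_scale) simp
  also have "complex_of_real (1 / (2 * pi)) powr (-s) = of_real (2 * pi) powr s"
    by (subst of_real_inverse_powr) simp_all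
  also have "mellin {0<..} (D \<beta> (-1)) s = - (of_real pi / sin (of_real pi * s) * exp (\<i> * of_real pi * s / 2)) *
           (\<Sum>n. of_real (\<beta> + real n) powr (s - 1))"
    unfolding D_def by (subst mellin_Digamma(2)) (use s pos in simp_all)
  also have "mellin {0<..} (D \<alpha> 1) s = - (of_real pi / sin (of_real pi * s) * exp (- (\<i> * of_real pi * s / 2))) *
           (\<Sum>n. of_real (\<alpha> + real n) powr (s - 1))"
    unfolding D_def by (subst mellin_Digamma(2)) (use s pos in simp_all)
  also have "\<i> / (2 * of_real pi) * (of_real (2 * pi) powr s *
        (- (of_real pi / sin (of_real pi * s) * exp (\<i> * of_real pi * s / 2)) *
          (\<Sum>n. of_real (\<beta> + real n) powr (s - 1))) -
      of_real (2 * pi) powr s * (- (of_real pi / sin (of_real pi * s) * exp (- (\<i> * of_real pi * s / 2))) *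
          (\<Sum>n. of_real (\<alpha> + real n) powr (s - 1)))) =
    \<i> / (2 * of_real pi) * of_real (2 * pi) powr s * (of_real pi / sin (of_real pi * s)) *
      (exp (- (\<i> * of_real pi * s / 2)) * (\<Sum>n. of_real (\<alpha> + real n) powr (s - 1)) -
       exp (\<i> * of_real pi * s / 2) * (\<Sum>n. of_real (\<beta> + real n) powr (s - 1)))"
    by (rule alg)
  finally show "mellin {0<..} (root_rem k c) s = \<i> / (2 * of_real pi) * of_real (2 * pi) powr s *
      (of_real pi / sin (of_real pi * s)) *
      (exp (- (\<i> * of_real pi * s / 2)) * (\<Sum>n. of_real (residue_rep k c / k + real n) powr (s - 1)) -
       exp (\<i> * of_real pi * s / 2) * (\<Sum>n. of_real (residue_rep k (-c) / k + real n) powr (s - 1)))"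
    unfolding \<alpha>_def [symmetric] \<beta>_def [symmetric] .
qed

section \<open>Dirichlet series of additive characters and of residue classes\<close>

definition dirichlet_series :: "(int \<Rightarrow> complex) \<Rightarrow> complex \<Rightarrow> complex" where
  "dirichlet_series f s = (\<Sum>n. f (int (Suc n)) * of_nat (Suc n) powr (-s))"

definition root_char :: "nat \<Rightarrow> int \<Rightarrow> int \<Rightarrow> complex" where
  "root_char k c n = e_fun (of_int (c * n) / of_nat k)"

definition residue_ind :: "nat \<Rightarrow> int \<Rightarrow> int \<Rightarrow> complex" where
  "residue_ind k c n = of_bool ([n = c] (mod int k))"

lemma summable_Suc_powr:
  assumes "\<sigma> < -1"
  shows "summable (\<lambda>n. real (Suc n) powr \<sigma>)"
  using summable_shifted_powr[OF zero_less_one assms] by (simp add: add_ac)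

text \<open>Each term of the geometric series contributes Gamma s * n powr (-s) times a root of
  unity; Re s > 1 makes the norms summable.\<close>

lemma root_geom_mellin:
  assumes s: "1 < Re s"
  shows "mellin_conv {0<..} (root_geom k c) s"
    and "mellin {0<..} (root_geom k c) s = Gamma s * dirichlet_series (root_char k c) s"
proof -
  define \<omega> where "\<omega> = e_fun (of_int c / of_nat k)"
  have \<omega>: "norm \<omega> = 1" by (simp add: \<omega>_def norm_e_fun_rational)
  define f where "f = (\<lambda>n x. \<omega> ^ Suc n * exp (- of_real (real (Suc n) * x)))"
  have \<omega>_pow: "\<omega> ^ Suc n = root_char k c (int (Suc n))" for n
    by (simp add: \<omega>_def root_char_def e_fun_def exp_of_nat_mult [symmetric] mult_ac flip: power_Suc)
  have f_eq: "f n x = (\<omega> * exp (- of_real x)) ^ Suc n" for n x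
    unfolding f_def power_mult_distrib exp_of_nat_mult [symmetric] by simp
  have q: "norm (\<omega> * exp (- of_real x)) < 1" if "x > 0" for x
    using that \<omega> by (simp add: norm_mult)
  have conv: "mellin_conv {0<..} (f n) s" for n
  proof -
    have "set_integrable lborel {0<..} (\<lambda>x. \<omega> ^ Suc n * (complex_of_real x powr (s - 1) * exp (- of_real (real (Suc n) * x))))"
      using mellin_exp(1)[of s "real (Suc n)"] s unfolding mellin_conv_def by (intro set_integrable_mult_right) auto
    thus ?thesis unfolding mellin_conv_def f_def by (simp only: mult_ac)
  qed
  have m: "mellin {0<..} (f n) s = \<omega> ^ Suc n * (Gamma s * of_nat (Suc n) powr (-s))" for n
  proof -
    have "mellin {0<..} (f n) s = \<omega> ^ Suc n * mellin {0<..} (\<lambda>x. exp (- of_real (real (Suc n) * x))) s"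
      unfolding mellin_def set_integral_mult_right [symmetric] f_def by (simp only: mult_ac)
    thus ?thesis using s by (subst (asm) mellin_exp(2)) auto
  qed
  have "norm (mellin {0<..} (\<lambda>x. of_real (norm (f n x))) (of_real (Re s))) =
     norm (Gamma (complex_of_real (Re s))) * real (Suc n) powr (- Re s)" for n
  proof -
    have "complex_of_real (norm (f n x)) = exp (- of_real (real (Suc n) * x))" for x
      by (simp add: f_def norm_mult norm_power \<omega> flip: exp_of_real)
    moreover have "mellin {0<..} (\<lambda>x. exp (- complex_of_real (real (Suc n) * x))) (of_real (Re s)) =
       Gamma (of_real (Re s)) * of_real (real (Suc n)) powr (- of_real (Re s))"
      by (rule mellin_exp(2)) (use s in auto)
    ultimately show ?thesis by (simp add: norm_mult norm_powr_real_powr del: of_nat_Suc)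
  qed
  hence sums: "summable (\<lambda>n. norm (mellin {0<..} (\<lambda>x. of_real (norm (f n x))) (of_real (Re s))))"
    using summable_Suc_powr[of "- Re s"] s by (simp only: summable_mult)
  have pw: "summable (\<lambda>n. norm (f n x))" if "x \<in> {0<..}" for x
    using q[of x] that unfolding f_eq norm_power by (subst summable_Suc_iff) (auto intro: summable_geometric)
  have sum_f: "(\<Sum>n. f n x) = root_geom k c x" if "x \<in> {0<..}" for x
    unfolding f_eq root_geom_def \<omega>_def [symmetric] power_Suc
    using q[of x] that by (subst suminf_mult) (auto simp: suminf_geometric summable_geometric)
  note * = mellin_suminf[OF subset_refl conv pw sums]
  show "mellin_conv {0<..} (root_geom k c) s"
    using *(1) unfolding mellin_conv_def
    by (rule set_integrable_cong[THEN iffD1, rotated 3]) (auto simp: sum_f)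
  have "mellin {0<..} (root_geom k c) s = mellin {0<..} (\<lambda>x. \<Sum>n. f n x) s"
    unfolding mellin_def by (rule set_lebesgue_integral_cong) (auto simp: sum_f)
  hence "(\<lambda>n. Gamma s * (root_char k c (int (Suc n)) * of_nat (Suc n) powr (-s))) sums mellin {0<..} (root_geom k c) s"
    using *(2) unfolding m \<omega>_pow by (simp only: mult_ac)
  moreover have "summable (\<lambda>n. root_char k c (int (Suc n)) * of_nat (Suc n) powr (-s))"
  proof (rule summable_norm_cancel)
    have "norm (root_char k c (int (Suc n)) * of_nat (Suc n) powr (-s)) = real (Suc n) powr (- Re s)" for n
      unfolding \<omega>_pow [symmetric] using norm_powr_real_powr[of "of_nat (Suc n)" "-s"]
      by (simp add: norm_mult norm_power \<omega> del: of_nat_Suc)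
    thus "summable (\<lambda>n. norm (root_char k c (int (Suc n)) * of_nat (Suc n) powr (-s)))"
      using summable_Suc_powr[of "- Re s"] s by simp
  qed
  ultimately show "mellin {0<..} (root_geom k c) s = Gamma s * dirichlet_series (root_char k c) s"
    unfolding dirichlet_series_def by (simp add: sums_iff suminf_mult)
qed

text \<open>Since \<open>residue_rep k c\<close> lies between 1 and k, the positive integers in the
  class of c are exactly its translates by k n with n \<ge> 0; taking out a factor k leaves a
  Hurwitz series.\<close>

lemma dirichlet_series_residue_ind:
  assumes k: "k > 0" and w: "Re w < -1"
  shows "dirichlet_series (residue_ind k c) (-w) =
     of_nat k powr w * (\<Sum>n. of_real (residue_rep k c / k + real n) powr w)"
proof -
  define p where "p = residue_rep k c"
  have p: "p > 0" "p \<le> k" "[int p = c] (mod int k)"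
  proof -
    show "p > 0" using residue_rep_pos[OF k] by (simp add: p_def)
    have c: "c mod int k < int k" "0 \<le> c mod int k" using k by auto
    show "p \<le> k" using c(1) unfolding p_def residue_rep_def by (simp add: nat_le_iff)
    show "[int p = c] (mod int k)"
    proof (cases "int k dvd c")
      case True
      thus ?thesis by (simp add: p_def residue_rep_def cong_def)
    next
      case False
      hence "int p = c mod int k" using c(2) by (simp add: p_def residue_rep_def)
      thus ?thesis by (simp add: cong_def)
    qed
  qed
  \<comment> \<open>The 1 is subtracted because the n-th term of the series belongs to the integer
    \<open>Suc n\<close>.\<close>
  define g where "g = (\<lambda>n. p + k * n - 1)"
  have Suc_g: "Suc (g n) = p + k * n" for n using p by (simp add: g_def)
  have sm: "strict_mono g"
    unfolding strict_mono_Suc_iff using k p by (auto simp: g_def)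
  define f where "f = (\<lambda>n. residue_ind k c (int (Suc n)) * of_nat (Suc n) powr w :: complex)"
  have "f m = 0" if "m \<notin> range g" for m
  proof (rule ccontr)
    assume "f m \<noteq> 0"
    hence "[int (Suc m) = c] (mod int k)" by (auto simp: f_def residue_ind_def split: if_splits)
    hence "[int (Suc m) = int p] (mod int k)" using p(3) by (metis cong_sym cong_trans)
    hence cong: "[Suc m = p] (mod k)" by (simp only: cong_int_iff)
    \<comment> \<open>p is the least positive member of its class: a smaller one would leave a
      positive difference below k that k divides.\<close>
    have "p \<le> Suc m"
    proof (rule ccontr)
      assume "\<not> p \<le> Suc m"
      hence "Suc m < p" by simp
      with cong p(2) have "k dvd p - Suc m"
        by (metis cong_altdef_nat cong_sym less_imp_le)
      hence "k \<le> p - Suc m" using \<open>Suc m < p\<close> by (intro dvd_imp_le) auto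
      thus False using p(2) \<open>Suc m < p\<close> by linarith
    qed
    with cong obtain n where "Suc m = p + k * n"
      by (metis cong_altdef_nat dvdE le_add_diff_inverse)
    hence "m = g n" using Suc_g[of n] by simp
    with that show False by simp
  qed
  hence reindex: "suminf f = (\<Sum>n. f (g n))"
    by (intro suminf_mono_reindex[OF sm, symmetric])
  have fg: "f (g n) = of_nat k powr w * of_real (p / k + real n) powr w" for n
  proof -
    have "[int p + int k * int n = c] (mod int k)"
      using p(3) by (simp add: cong_def)
    hence "f (g n) = of_nat (p + k * n) powr w"
      unfolding f_def Suc_g residue_ind_def by simp
    also have "complex_of_nat (p + k * n) = of_real (real k * (p / k + real n))"
      using k by (simp add: distrib_left)
    also have "\<dots> powr w = of_real (real k) powr w * of_real (p / k + real n) powr w"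
      by (rule powr_of_real_mult) (use k p in \<open>auto intro!: add_pos_nonneg\<close>)
    finally show ?thesis by simp
  qed
  note reindex
  also have "(\<Sum>n. f (g n)) = (\<Sum>n. of_nat k powr w * complex_of_real (p / k + real n) powr w)"
    by (simp only: fg)
  also have "\<dots> =
      of_nat k powr w * (\<Sum>n. complex_of_real (p / k + real n) powr w)"
  proof (rule suminf_mult, rule summable_norm_cancel)
    have "p / k > 0" using k p by simp
    thus "summable (\<lambda>n. norm (complex_of_real (p / k + real n) powr w))"
      using summable_shifted_powr[OF _ w, of "p / k"]
      by (simp add: norm_powr_real_powr add_nonneg_nonneg)
  qed
  finally show ?thesis by (simp add: dirichlet_series_def f_def [abs_def] p_def)
qed

lemma dirichlet_series_holomorphic:
  assumes f: "\<And>n. norm (f n) \<le> C"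
  shows "dirichlet_series f holomorphic_on {s. 1 < Re s}"
proof (rule holomorphic_uniform_sequence)
  show "open {s. 1 < Re s}" by (rule open_halfspace_Re_gt)
  show "(\<lambda>s. \<Sum>i<n. f (int (Suc i)) * of_nat (Suc i) powr (-s)) holomorphic_on {s. 1 < Re s}" for n
    by (intro holomorphic_intros)
  fix s0 assume "s0 \<in> {s. 1 < Re s}"
  hence s0: "1 < Re s0" by simp
  define d where "d = (Re s0 - 1) / 2"
  have d: "d > 0" "1 < Re s0 - d" using s0 by (auto simp: d_def field_simps)
  have Re_s: "Re s0 - d \<le> Re s" if "s \<in> cball s0 d" for s
    using abs_Re_le_cmod[of "s0 - s"] that by (simp add: dist_norm)
  have "uniform_limit (cball s0 d) (\<lambda>n s. \<Sum>i<n. f (int (Suc i)) * of_nat (Suc i) powr (-s))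
      (\<lambda>s. \<Sum>i. f (int (Suc i)) * of_nat (Suc i) powr (-s)) sequentially"
  proof (rule Weierstrass_m_test)
    show "summable (\<lambda>n. C * real (Suc n) powr (- (Re s0 - d)))"
      by (intro summable_mult summable_Suc_powr) (use d in auto)
    fix n s assume s: "s \<in> cball s0 d"
    have "norm (f (int (Suc n)) * of_nat (Suc n) powr (-s)) = norm (f (int (Suc n))) * real (Suc n) powr (- Re s)"
      using norm_powr_real_powr[of "of_nat (Suc n)" "-s"] by (simp add: norm_mult del: of_nat_Suc)
    also have "\<dots> \<le> C * real (Suc n) powr (- (Re s0 - d))"
      by (intro mult_mono f powr_mono order.trans[OF norm_ge_zero f[of 0]]) (use Re_s[OF s] in auto)
    finally show "norm (f (int (Suc n)) * of_nat (Suc n) powr (-s)) \<le> C * real (Suc n) powr (- (Re s0 - d))" .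
  qed
  moreover have "cball s0 d \<subseteq> {s. 1 < Re s}"
    using Re_s d by (force intro: less_le_trans)
  ultimately show "\<exists>d>0. cball s0 d \<subseteq> {s. 1 < Re s} \<and>
      uniform_limit (cball s0 d) (\<lambda>n s. \<Sum>i<n. f (int (Suc i)) * of_nat (Suc i) powr (-s)) (dirichlet_series f) sequentially"
    unfolding dirichlet_series_def [abs_def] using d by blast
qed

lemma norm_root_char: "norm (root_char k c n) = 1"
  unfolding root_char_def by (rule norm_e_fun_rational)

lemma norm_residue_ind: "norm (residue_ind k c n) \<le> 1"
  by (simp add: residue_ind_def)

text \<open>The right-hand side of the functional equation, written with series that converge for
  \<open>Re s < 0\<close>; it serves as the definition of the continuation to the left half-plane.\<close>

definition periodic_zeta_dual :: "nat \<Rightarrow> int \<Rightarrow> complex \<Rightarrow> complex" where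
  "periodic_zeta_dual k c s = Gamma (1 - s) * of_real (2 * pi) powr (s - 1) * of_nat k powr (1 - s) *
     (exp (- (\<i> * of_real pi * (s - 1) / 2)) * dirichlet_series (residue_ind k c) (1 - s) +
      exp (\<i> * of_real pi * (s - 1) / 2) * dirichlet_series (residue_ind k (-c)) (1 - s))"

lemma periodic_zeta_dual_holomorphic:
  assumes "k > 0"
  shows "periodic_zeta_dual k c holomorphic_on {s. Re s < 0}"
proof -
  have "(\<lambda>s. dirichlet_series (residue_ind k a) (1 - s)) holomorphic_on {s. Re s < 0}" for a
  proof -
    have "(dirichlet_series (residue_ind k a) \<circ> (\<lambda>s. 1 - s)) holomorphic_on {s. Re s < 0}"
      by (rule holomorphic_on_compose_gen[OF _ dirichlet_series_holomorphic[OF norm_residue_ind]])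
         (auto intro!: holomorphic_intros)
    thus ?thesis by (simp add: o_def)
  qed
  moreover have "1 - s \<notin> \<int>\<^sub>\<le>\<^sub>0" if "Re s < 0" for s :: complex
    using that by (auto elim!: nonpos_Ints_cases simp: complex_eq_iff)
  ultimately show ?thesis
    unfolding periodic_zeta_dual_def using assms by (intro holomorphic_intros) auto
qed

text \<open>The entire function \<open>rGamma\<close> removes the Gamma factor of the Mellin
  transform. Holomorphy is claimed only off the integers: at 1 there may be a pole, and at 0 the
  formula evaluates B/0 to 0, so its value there need not be the limit.\<close>

lemma periodic_zeta_strip:
  assumes k: "k > 0"
  obtains F where "F holomorphic_on {s. -1 < Re s} - \<int>" "F meromorphic_on {s. -1 < Re s}"
    "\<And>s. 1 < Re s \<Longrightarrow> F s = dirichlet_series (root_char k c) s"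
    "\<And>s. -1 < Re s \<Longrightarrow> Re s < 0 \<Longrightarrow> F s = periodic_zeta_dual k c s"
proof -
  define A :: complex where "A = (if int k dvd c then 1 else 0)"
  obtain B where B: "\<And>x. x > 0 \<Longrightarrow> root_geom k c x = A / of_real x + B + root_rem k c x"
    using root_geom_expansion[OF k, of c] unfolding A_def by metis
  have "norm (e_fun (of_int c / of_nat k) * exp (- of_real x)) < 1" if "x > 0" for x
    using that by (simp add: norm_mult norm_e_fun_rational)
  hence "1 - e_fun (of_int c / of_nat k) * exp (- of_real x) \<noteq> 0" if "x > 0" for x
    using that by (metis less_irrefl norm_one right_minus_eq)
  hence g: "continuous_on {0<..} (root_geom k c)"
    unfolding root_geom_def by (intro continuous_intros) auto
  have "continuous_on {0<..} (\<lambda>x. root_geom k c x - A / of_real x - B)"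
    by (intro continuous_intros g) auto
  hence r: "continuous_on {0<..} (root_rem k c)"
    by (rule continuous_on_eq) (simp add: B)
  obtain H where H: "H holomorphic_on {s. -1 < Re s}"
    "\<And>s. 1 < Re s \<Longrightarrow> mellin {0<..} (root_geom k c) s = H s + A / (s - 1) + B / s"
    "\<And>s. -1 < Re s \<Longrightarrow> Re s < 0 \<Longrightarrow> mellin {0<..} (root_rem k c) s = H s + A / (s - 1) + B / s"
    using mellin_continuation[OF g r B root_rem_mellin(1)[OF k] root_geom_mellin(1)] by metis
  define F where "F = (\<lambda>s. rGamma s * (H s + A / (s - 1) + B / s))"
  have "H holomorphic_on {s. -1 < Re s} - \<int>" by (rule holomorphic_on_subset[OF H(1)]) auto
  hence 1: "F holomorphic_on {s. -1 < Re s} - \<int>"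
    unfolding F_def by (intro holomorphic_intros) auto
  have "H meromorphic_on {s. -1 < Re s}"
    using H(1) by (intro analytic_on_imp_meromorphic_on) (simp add: analytic_on_open open_halfspace_Re_gt)
  moreover have "rGamma meromorphic_on {s. -1 < Re s}"
    by (intro analytic_on_imp_meromorphic_on) (simp add: analytic_on_open open_halfspace_Re_gt holomorphic_rGamma)
  ultimately have 2: "F meromorphic_on {s. -1 < Re s}"
    unfolding F_def by (intro meromorphic_intros)
  have rG: "rGamma s * Gamma s = 1" if "s \<notin> \<int>\<^sub>\<le>\<^sub>0" for s :: complex
    using that by (simp add: Gamma_def rGamma_eq_zero_iff)
  have 3: "F s = dirichlet_series (root_char k c) s" if s: "1 < Re s" for s
  proof -
    have "s \<notin> \<int>\<^sub>\<le>\<^sub>0" using s by (auto elim!: nonpos_Ints_cases)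
    thus ?thesis
      unfolding F_def H(2)[OF s, symmetric] root_geom_mellin(2)[OF s]
      using rG[of s] by (simp flip: mult.assoc)
  qed
  have 4: "F s = periodic_zeta_dual k c s" if s: "-1 < Re s" "Re s < 0" for s
  proof -
    have ni: "s \<notin> \<int>\<^sub>\<le>\<^sub>0" using s by (auto elim!: nonpos_Ints_cases)
    have DS: "dirichlet_series (residue_ind k a) (1 - s) =
        of_nat k powr (s - 1) * (\<Sum>n. of_real (residue_rep k a / k + real n) powr (s - 1))" for a
      using dirichlet_series_residue_ind[OF k, of "s - 1" a] s by simp
    define Sa where "Sa = (\<lambda>a. \<Sum>n. complex_of_real (residue_rep k a / k + real n) powr (s - 1))"
    define E where "E = exp (\<i> * of_real pi * s / 2)"
    define E' where "E' = exp (- (\<i> * of_real pi * s / 2))"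
    \<comment> \<open>Passing from s to s - 1 in the exponentials produces the factors i and -i.
      They absorb the i of \<open>root_rem_mellin\<close> and turn its difference into the sum of
      the dual expression.\<close>
    have half: "exp (\<i> * of_real pi / 2) = \<i>" "exp (- (\<i> * of_real pi / 2)) = - \<i>"
      by (simp_all add: complex_eq_iff Re_exp Im_exp)
    have "- (\<i> * of_real pi * (s - 1) / 2) = - (\<i> * of_real pi * s / 2) + \<i> * of_real pi / 2"
      "\<i> * of_real pi * (s - 1) / 2 = \<i> * of_real pi * s / 2 + - (\<i> * of_real pi / 2)"
      by (simp_all add: algebra_simps diff_divide_distrib)
    hence E1: "exp (- (\<i> * of_real pi * (s - 1) / 2)) = E' * \<i>"
      and E2: "exp (\<i> * of_real pi * (s - 1) / 2) = E * (- \<i>)"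
      unfolding E_def E'_def by (simp_all only: exp_add half)
    have kk: "of_nat k powr (1 - s) * of_nat k powr (s - 1) = (1 :: complex)"
      using k by (simp flip: powr_add)
    have pp: "complex_of_real (2 * pi) powr (s - 1) = of_real (2 * pi) powr s / (2 * of_real pi)"
      by (subst powr_diff) simp
    have dual: "periodic_zeta_dual k c s = Gamma (1 - s) * (of_real (2 * pi) powr s / (2 * of_real pi)) *
       (of_nat k powr (1 - s) * of_nat k powr (s - 1)) * (E' * \<i> * Sa c - E * \<i> * Sa (-c))"
      unfolding periodic_zeta_dual_def DS E1 E2 pp Sa_def by (simp add: algebra_simps)
    have "F s = rGamma s * mellin {0<..} (root_rem k c) s"
      unfolding F_def H(3)[OF s] ..
    also have "\<dots> = rGamma s * (\<i> / (2 * of_real pi) * of_real (2 * pi) powr s *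
      (Gamma s * Gamma (1 - s)) * (E' * Sa c - E * Sa (-c)))"
      unfolding root_rem_mellin(2)[OF k s] Gamma_reflection_complex E_def E'_def Sa_def ..
    also have "\<dots> = (rGamma s * Gamma s) * (Gamma (1 - s) * (of_real (2 * pi) powr s / (2 * of_real pi)) *
         (E' * \<i> * Sa c - E * \<i> * Sa (-c)))"
      by (simp add: algebra_simps)
    also have "\<dots> = periodic_zeta_dual k c s"
      unfolding rG[OF ni] dual kk by simp
    finally show ?thesis .
  qed
  show ?thesis by (rule that[OF 1 2 3 4])
qed

section \<open>Finite Fourier analysis and continuation to the whole plane\<close>

lemma e_fun_eq_1_iff:
  assumes "k > 0"
  shows "e_fun (of_int n / of_nat k) = 1 \<longleftrightarrow> int k dvd n"
proof
  assume "e_fun (of_int n / of_nat k) = 1"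
  then obtain m :: int where "Im (2 * of_real pi * \<i> * (of_int n / of_nat k)) = of_int (2 * m) * pi"
    unfolding e_fun_def exp_eq_1 by blast
  moreover have "2 * of_real pi * \<i> * (of_int n / of_nat k) = complex_of_real (2 * pi * (of_int n / of_nat k)) * \<i>"
    by (simp add: mult_ac)
  ultimately have "2 * pi * (of_int n / of_nat k) = of_int (2 * m) * pi"
    by (metis Im_complex_of_real complex_i_mult_minus Im_i_times Re_complex_of_real mult.commute)
  hence "(2 * pi) * (real_of_int n / real k) = (2 * pi) * real_of_int m"
    by (simp add: mult_ac)
  hence "real_of_int n / real k = real_of_int m"
    by (subst (asm) mult_cancel_left) simp
  hence "real_of_int n = real_of_int (m * int k)"
    using assms by (simp add: field_simps)
  hence "n = m * int k" by (simp only: of_int_eq_iff)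
  thus "int k dvd n" by simp
next
  assume "int k dvd n"
  hence "[n = 0] (mod int k)" by (simp add: cong_0_iff)
  from e_fun_cong[OF assms this] show "e_fun (of_int n / of_nat k) = 1"
    using e_fun_of_int[of 0] by simp
qed

lemma e_fun_mult_nat: "e_fun (of_nat j * z) = e_fun z ^ j"
  by (simp add: e_fun_def exp_of_nat_mult [symmetric] mult_ac)

text \<open>The summand is w^j for a k-th root of unity w, so the geometric sum is k if w = 1 and 0
  otherwise.\<close>

lemma root_char_orthogonality:
  assumes k: "k > 0"
  shows "(\<Sum>j<k. root_char k (-c) (int j) * root_char k (int j) n) = of_nat k * residue_ind k c n"
proof -
  define w where "w = e_fun (of_int (n - c) / of_nat k)"
  have "root_char k (-c) (int j) * root_char k (int j) n = w ^ j" for j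
    unfolding root_char_def w_def e_fun_mult_nat [symmetric] e_fun_add [symmetric]
    by (simp add: algebra_simps diff_divide_distrib)
  hence eq: "(\<Sum>j<k. root_char k (-c) (int j) * root_char k (int j) n) = (\<Sum>j<k. w ^ j)"
    by simp
  have w1: "w = 1 \<longleftrightarrow> [n = c] (mod int k)"
    unfolding w_def e_fun_eq_1_iff[OF k] by (simp add: cong_iff_dvd_diff)
  have "w ^ k = e_fun (of_int (n - c))"
    unfolding w_def e_fun_mult_nat [symmetric] using k by simp
  hence "w ^ k = 1" by (simp only: e_fun_of_int)
  thus ?thesis
    unfolding eq using w1 by (cases "w = 1") (auto simp: residue_ind_def sum_gp_strict)
qed

lemma dirichlet_series_summable:
  assumes f: "\<And>n. norm (f n) \<le> C" and s: "1 < Re s"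
  shows "summable (\<lambda>n. norm (f (int (Suc n)) * of_nat (Suc n) powr (-s)))"
proof (rule summable_comparison_test')
  show "summable (\<lambda>n. C * real (Suc n) powr (- Re s))"
    by (intro summable_mult summable_Suc_powr) (use s in auto)
  fix n
  have "norm (f (int (Suc n)) * of_nat (Suc n) powr (-s)) = norm (f (int (Suc n))) * real (Suc n) powr (- Re s)"
    using norm_powr_real_powr[of "of_nat (Suc n)" "-s"] by (simp add: norm_mult del: of_nat_Suc)
  also have "\<dots> \<le> C * real (Suc n) powr (- Re s)"
    by (intro mult_right_mono f) auto
  finally show "norm (norm (f (int (Suc n)) * of_nat (Suc n) powr (-s))) \<le> C * real (Suc n) powr (- Re s)"
    by simp
qed

text \<open>The right-hand side is a finite combination of periodic zeta functions, so it continues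
  to the plane as soon as they do; this is the source of \<open>residue_comb\<close>.\<close>

lemma residue_ind_series_eq_sum:
  assumes k: "k > 0" and s: "1 < Re s"
  shows "dirichlet_series (residue_ind k c) s =
    (\<Sum>j<k. root_char k (-c) (int j) * dirichlet_series (root_char k (int j)) s) / of_nat k"
proof -
  have sm: "summable (\<lambda>n. root_char k (int j) (int (Suc n)) * of_nat (Suc n) powr (-s))" for j
    by (rule summable_norm_cancel, rule dirichlet_series_summable[OF _ s]) (rule eq_refl, rule norm_root_char)
  have "(\<Sum>j<k. root_char k (-c) (int j) * dirichlet_series (root_char k (int j)) s) =
     (\<Sum>j<k. \<Sum>n. root_char k (-c) (int j) * (root_char k (int j) (int (Suc n)) * of_nat (Suc n) powr (-s)))"
    unfolding dirichlet_series_def by (intro sum.cong refl suminf_mult [symmetric] sm)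
  also have "\<dots> = (\<Sum>n. \<Sum>j<k. root_char k (-c) (int j) * (root_char k (int j) (int (Suc n)) * of_nat (Suc n) powr (-s)))"
    by (intro suminf_sum [symmetric] summable_mult sm)
  also have "\<dots> = (\<Sum>n. of_nat k * (residue_ind k c (int (Suc n)) * of_nat (Suc n) powr (-s)))"
    unfolding mult.assoc [symmetric] sum_distrib_right [symmetric] root_char_orthogonality[OF k] ..
  also have "\<dots> = of_nat k * dirichlet_series (residue_ind k c) s"
    unfolding dirichlet_series_def
    by (intro suminf_mult summable_norm_cancel[OF dirichlet_series_summable[OF _ s]]) (rule norm_residue_ind)
  finally show ?thesis using k by simp
qed

text \<open>The function on the right and the dual expression are glued along -1 < Re s < 0.
  Dependence on c only modulo k is required as an equality of functions, exceptional points
  included, so that residues can be substituted freely in finite sums.\<close>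

lemma periodic_zeta_continuation:
  assumes k: "k > 0"
  obtains F where
    "\<And>c. F c holomorphic_on - \<int>" "\<And>c. F c meromorphic_on UNIV"
    "\<And>c s. 1 < Re s \<Longrightarrow> F c s = dirichlet_series (root_char k c) s"
    "\<And>c s. Re s < 0 \<Longrightarrow> F c s = periodic_zeta_dual k c s"
    "\<And>a b. [a = b] (mod int k) \<Longrightarrow> F a = F b"
proof -
  have "\<exists>F. F holomorphic_on {s. -1 < Re s} - \<int> \<and> F meromorphic_on {s. -1 < Re s} \<and>
    (\<forall>s. 1 < Re s \<longrightarrow> F s = dirichlet_series (root_char k c) s) \<and>
    (\<forall>s. -1 < Re s \<and> Re s < 0 \<longrightarrow> F s = periodic_zeta_dual k c s)" for c
    using periodic_zeta_strip[OF k, of c] by metis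
  then obtain F0 where F0: "\<And>c. F0 c holomorphic_on {s. -1 < Re s} - \<int>"
    "\<And>c. F0 c meromorphic_on {s. -1 < Re s}"
    "\<And>c s. 1 < Re s \<Longrightarrow> F0 c s = dirichlet_series (root_char k c) s"
    "\<And>c s. -1 < Re s \<Longrightarrow> Re s < 0 \<Longrightarrow> F0 c s = periodic_zeta_dual k c s"
    by metis
  \<comment> \<open>The functions \<open>F0 c\<close> are chosen separately for each c, so congruent
    c could differ at integers; reducing c modulo k first makes them equal by construction.\<close>
  define F where "F = (\<lambda>c s. if -1 < Re s then F0 (c mod int k) s else periodic_zeta_dual k (c mod int k) s)"
  have dual_mod: "periodic_zeta_dual k (c mod int k) = periodic_zeta_dual k c" for c
  proof -
    have "residue_ind k (c mod int k) = residue_ind k c" "residue_ind k (- (c mod int k)) = residue_ind k (- c)"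
      by (intro ext; simp add: residue_ind_def cong_def mod_minus_eq)+
    thus ?thesis unfolding periodic_zeta_dual_def [abs_def] by simp
  qed
  have char_mod: "root_char k (c mod int k) = root_char k c" for c
  proof
    fix n
    have "[c mod int k * n = c * n] (mod int k)" by (simp add: cong_def mod_mult_left_eq)
    thus "root_char k (c mod int k) n = root_char k c n"
      unfolding root_char_def by (rule e_fun_cong[OF k])
  qed
  have F_left: "F c s = periodic_zeta_dual k c s" if "Re s < 0" for c s
    using that F0(4) by (simp add: F_def dual_mod)
  have o: "open {s. -1 < Re s}" "open {s. Re s < 0}"
    by (rule open_halfspace_Re_gt open_halfspace_Re_lt)+
  have h1: "F c holomorphic_on {s. -1 < Re s} - \<int>" for c
    by (rule holomorphic_transform[OF F0(1)[of "c mod int k"]]) (simp add: F_def)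
  have h2: "F c holomorphic_on {s. Re s < 0}" for c
    by (rule holomorphic_transform[OF periodic_zeta_dual_holomorphic[OF k, of c]]) (simp add: F_left)
  have "F c holomorphic_on ({s. -1 < Re s} - \<int>) \<union> {s. Re s < 0}" for c
    by (intro holomorphic_on_Un h1 h2 o open_Diff closed_Ints)
  hence 1: "F c holomorphic_on - \<int>" for c
    by (rule holomorphic_on_subset) auto
  have "F c meromorphic_on {s. -1 < Re s}" for c
  proof -
    have "F c meromorphic_on {s. -1 < Re s} \<longleftrightarrow> F0 (c mod int k) meromorphic_on {s. -1 < Re s}"
    proof (rule meromorphic_on_cong)
      fix z assume "z \<in> {s. -1 < Re s}"
      hence "eventually (\<lambda>w. w \<in> {s. -1 < Re s}) (at z)"
        using o(1) by (intro eventually_at_in_open') auto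
      thus "eventually (\<lambda>w. F c w = F0 (c mod int k) w) (at z)"
        by eventually_elim (simp add: F_def)
    qed simp
    thus ?thesis using F0(2) by simp
  qed
  moreover have "F c meromorphic_on {s. Re s < 0}" for c
    using h2 o(2) by (intro analytic_on_imp_meromorphic_on) (simp add: analytic_on_open)
  ultimately have "F c meromorphic_on {s. -1 < Re s} \<union> {s. Re s < 0}" for c
    by (intro meromorphic_on_Un)
  hence 2: "F c meromorphic_on UNIV" for c
    by (rule meromorphic_on_subset) auto
  have 3: "F c s = dirichlet_series (root_char k c) s" if "1 < Re s" for c s
    using that F0(3)[of s "c mod int k"] by (simp add: F_def char_mod)
  have 4: "F a = F b" if "[a = b] (mod int k)" for a b
  proof -
    have "a mod int k = b mod int k" using that by (simp add: cong_def)
    thus ?thesis unfolding F_def by (simp only:)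
  qed
  show ?thesis by (rule that[OF 1 2 3 F_left 4])
qed

text \<open>For the periodic zeta functions \<open>F\<close> and Re s > 1 this is the series over
  the class of c, by \<open>residue_ind_series_eq_sum\<close>; in general it is the continuation of
  that series, the function \<open>L\<^sub>c\<close> of the overview.\<close>

definition residue_comb :: "nat \<Rightarrow> (int \<Rightarrow> complex \<Rightarrow> complex) \<Rightarrow> int \<Rightarrow> complex \<Rightarrow> complex" where
  "residue_comb k F c s = (\<Sum>j<k. root_char k (-c) (int j) * F (int j) s) / of_nat k"

text \<open>For Re s < 0 off the integers this is \<open>periodic_zeta_dual\<close> itself, as the
  residue series converge at 1 - s. Both sides are holomorphic off the integers, a set preserved by
  s \<mapsto> 1 - s, and the complement of a countable set is connected, so the identity theorem
  applies.\<close>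

lemma periodic_zeta_functional_equation:
  assumes k: "k > 0"
    and hol: "\<And>c. F c holomorphic_on - \<int>"
    and series: "\<And>c s. 1 < Re s \<Longrightarrow> F c s = dirichlet_series (root_char k c) s"
    and dual: "\<And>c s. Re s < 0 \<Longrightarrow> F c s = periodic_zeta_dual k c s"
    and s: "s \<notin> \<int>"
  shows "F c s = Gamma (1 - s) * of_real (2 * pi) powr (s - 1) * of_nat k powr (1 - s) *
     (exp (- (\<i> * of_real pi * (s - 1) / 2)) * residue_comb k F c (1 - s) +
      exp (\<i> * of_real pi * (s - 1) / 2) * residue_comb k F (-c) (1 - s))"
proof (rule analytic_continuation_open[of "{s. Re s < 0} - \<int>" "- \<int>" "F c"
       "\<lambda>s. Gamma (1 - s) * of_real (2 * pi) powr (s - 1) * of_nat k powr (1 - s) *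
     (exp (- (\<i> * of_real pi * (s - 1) / 2)) * residue_comb k F c (1 - s) +
      exp (\<i> * of_real pi * (s - 1) / 2) * residue_comb k F (-c) (1 - s))"])
  show "open ({s. Re s < 0} - \<int>)" "open (- \<int> :: complex set)"
    by (intro open_Diff open_halfspace_Re_lt closed_Ints open_Compl)+
  have "-(1/2) \<in> {s :: complex. Re s < 0} - \<int>"
    using fraction_not_in_Ints[of 2 1, where ?'a = complex] by auto
  thus "{s :: complex. Re s < 0} - \<int> \<noteq> {}" by blast
  have "connected (UNIV - \<int> :: complex set)"
    by (rule connected_open_diff_countable) (auto simp: Ints_def)
  thus "connected (- \<int> :: complex set)" by (simp add: Compl_eq_Diff_UNIV)
  have minus: "1 - z \<notin> \<int>" if "z \<notin> \<int>" for z :: complex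
    using that Ints_diff[of 1 "1 - z"] by auto
  have "(\<lambda>s. F a (1 - s)) holomorphic_on - \<int>" for a
  proof -
    have "(F a \<circ> (\<lambda>s. 1 - s)) holomorphic_on - \<int>"
      by (rule holomorphic_on_compose_gen[OF _ hol]) (use minus in \<open>auto intro!: holomorphic_intros\<close>)
    thus ?thesis by (simp add: o_def)
  qed
  moreover have "1 - z \<notin> \<int>\<^sub>\<le>\<^sub>0" if "z \<notin> \<int>" for z :: complex
    using minus[OF that] nonpos_Ints_Int by blast
  ultimately show "(\<lambda>s. Gamma (1 - s) * of_real (2 * pi) powr (s - 1) * of_nat k powr (1 - s) *
     (exp (- (\<i> * of_real pi * (s - 1) / 2)) * residue_comb k F c (1 - s) +
      exp (\<i> * of_real pi * (s - 1) / 2) * residue_comb k F (-c) (1 - s))) holomorphic_on - \<int>"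
    using k unfolding residue_comb_def by (intro holomorphic_intros) auto
  fix z :: complex assume z: "z \<in> {s. Re s < 0} - \<int>"
  have "residue_comb k F a (1 - z) = dirichlet_series (residue_ind k a) (1 - z)" for a
    using z unfolding residue_comb_def by (subst residue_ind_series_eq_sum[OF k]) (auto simp: series)
  thus "F c z = Gamma (1 - z) * of_real (2 * pi) powr (z - 1) * of_nat k powr (1 - z) *
     (exp (- (\<i> * of_real pi * (z - 1) / 2)) * residue_comb k F c (1 - z) +
      exp (\<i> * of_real pi * (z - 1) / 2) * residue_comb k F (-c) (1 - z))"
    using z by (simp add: dual periodic_zeta_dual_def)
qed (use hol s in auto)

section \<open>The Estermann function as a finite sum\<close>

text \<open>Absolute convergence allows the double series to be summed along the finite fibres (i +
  1)(j + 1) = n + 1, which partition all pairs.\<close>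

lemma sums_dirichlet_convolution:
  fixes u v :: "nat \<Rightarrow> complex"
  assumes u: "summable (\<lambda>n. norm (u n))" and v: "summable (\<lambda>n. norm (v n))"
  shows "(\<lambda>n. \<Sum>(i, j) | Suc i * Suc j = Suc n. u i * v j) sums (suminf u * suminf v)"
proof -
  have hu: "(u has_sum suminf u) UNIV" and hv: "(v has_sum suminf v) UNIV"
    using u v by (auto intro!: norm_summable_imp_has_sum summable_sums summable_norm_cancel)
  have nu: "(\<lambda>n. norm (u n)) summable_on UNIV" and nv: "((\<lambda>n. norm (v n)) has_sum (\<Sum>n. norm (v n))) UNIV"
    using u v by (auto intro!: norm_summable_imp_summable_on norm_summable_imp_has_sum summable_sums)
  define f where "f = (\<lambda>p. norm (u (fst p)) * norm (v (snd p)))"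
  have hf: "((\<lambda>j. f (i, j)) has_sum (norm (u i) * (\<Sum>n. norm (v n)))) UNIV" for i
    unfolding f_def fst_conv snd_conv by (rule has_sum_cmult_right[OF nv])
  have hg: "(\<lambda>i. norm (u i) * (\<Sum>n. norm (v n))) summable_on UNIV"
    by (rule summable_on_cmult_left[OF nu])
  have "f (i, j) \<ge> 0" for i j by (simp add: f_def)
  with hf hg have "f summable_on (UNIV \<times> UNIV)"
    by (rule summable_on_SigmaI)
  hence "(\<lambda>p. norm (u (fst p) * v (snd p))) summable_on (UNIV \<times> UNIV)"
    by (simp only: f_def norm_mult)
  hence "(\<lambda>p. u (fst p) * v (snd p)) summable_on (UNIV \<times> UNIV)"
    by (rule abs_summable_summable)
  hence "((\<lambda>p. u (fst p) * v (snd p)) has_sum (suminf u * suminf v)) (UNIV \<times> UNIV)"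
    by (intro has_sum_SigmaI[where g = "\<lambda>i. u i * suminf v"])
       (auto intro!: has_sum_cmult_right has_sum_cmult_left hu hv)
  \<comment> \<open>A pair (i, j) is sent to the fibre with index (i + 1)(j + 1) - 1; the inverse
    forgets the index.\<close>
  also have "?this \<longleftrightarrow> ((\<lambda>q. u (fst (snd q)) * v (snd (snd q))) has_sum (suminf u * suminf v))
      (SIGMA n:UNIV. {(i, j). Suc i * Suc j = Suc n})"
    by (rule has_sum_reindex_bij_witness[of _ snd "\<lambda>p. (Suc (fst p) * Suc (snd p) - 1, p)"]) auto
  finally have S: "((\<lambda>q. u (fst (snd q)) * v (snd (snd q))) has_sum (suminf u * suminf v))
      (SIGMA n:UNIV. {(i, j). Suc i * Suc j = Suc n})" .
  have fiber: "((\<lambda>y. u (fst (snd (n, y))) * v (snd (snd (n, y)))) has_sum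
      (\<Sum>p\<in>{(i, j). Suc i * Suc j = Suc n}. u (fst p) * v (snd p))) {(i, j). Suc i * Suc j = Suc n}" for n
  proof -
    have "{(i, j). Suc i * Suc j = Suc n} \<subseteq> {..n} \<times> {..n}"
    proof
      fix p assume "p \<in> {(i, j). Suc i * Suc j = Suc n}"
      then obtain i j where p: "p = (i, j)" and *: "Suc i * Suc j = Suc n" by blast
      have "Suc i \<le> Suc i * Suc j" "Suc j \<le> Suc i * Suc j" by simp_all
      with * show "p \<in> {..n} \<times> {..n}" unfolding p by simp
    qed
    hence "finite {(i, j). Suc i * Suc j = Suc n}" by (rule finite_subset) auto
    from has_sum_finite[OF this, of "\<lambda>p. u (fst p) * v (snd p)"]
    show ?thesis by simp
  qed
  from has_sum_SigmaD[OF S fiber]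
  show ?thesis by (intro has_sum_imp_sums) (simp add: case_prod_unfold)
qed

lemma sum_divisor_pairs:
  fixes f :: "nat \<Rightarrow> nat \<Rightarrow> 'a :: comm_monoid_add"
  shows "(\<Sum>(i, j) | Suc i * Suc j = Suc n. f (Suc i) (Suc j)) = (\<Sum>d | d dvd Suc n. f d (Suc n div d))"
proof (rule sum.reindex_bij_witness[of _ "\<lambda>d. (d - 1, Suc n div d - 1)" "\<lambda>p. Suc (fst p)"])
  fix p assume "p \<in> {(i, j). Suc i * Suc j = Suc n}"
  then obtain i j where p: "p = (i, j)" and n: "Suc n = Suc i * Suc j" by auto
  have *: "Suc n div Suc i = Suc j" unfolding n by (rule nonzero_mult_div_cancel_left) simp
  show "(Suc (fst p) - 1, Suc n div Suc (fst p) - 1) = p"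
    unfolding p fst_conv * by simp
  show "f (Suc (fst p)) (Suc n div Suc (fst p)) = (case p of (i, j) \<Rightarrow> f (Suc i) (Suc j))"
    unfolding p fst_conv * by simp
  show "Suc (fst p) \<in> {d. d dvd Suc n}"
    unfolding p fst_conv mem_Collect_eq n by (rule dvd_triv_left)
next
  fix d assume "d \<in> {d. d dvd Suc n}"
  then obtain m where m: "Suc n = d * m" by (auto elim: dvdE)
  hence "d > 0" "m > 0" by (auto intro!: Nat.gr0I)
  hence "Suc n div d = m" "Suc (d - 1) = d" "Suc (m - 1) = m" using m by simp_all
  thus "(d - 1, Suc n div d - 1) \<in> {(i, j). Suc i * Suc j = Suc n}" "Suc (fst (d - 1, Suc n div d - 1)) = d"
    using m by (simp_all only: mem_Collect_eq case_prod_conv fst_conv)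
qed

lemma sum_residue_ind:
  assumes k: "k > 0" and per: "\<And>a b. [a = b] (mod int k) \<Longrightarrow> g a = g b"
  shows "(\<Sum>a<k. residue_ind k (int a) d * g (int a)) = g d"
proof -
  define r where "r = nat (d mod int k)"
  have r: "r < k" "int r = d mod int k" using k by (auto simp: r_def nat_less_iff)
  have "[d = int a] (mod int k) \<longleftrightarrow> a = r" if "a < k" for a
    using that r by (auto simp: cong_def)
  hence "(\<Sum>a<k. residue_ind k (int a) d * g (int a)) = (\<Sum>a<k. if a = r then g (int r) else 0)"
    by (intro sum.cong) (auto simp: residue_ind_def)
  also have "\<dots> = g (int r)" using r by (simp add: sum.delta')
  also have "\<dots> = g d" by (rule per) (simp add: r cong_def)
  finally show ?thesis .
qed

lemma root_char_cong:
  assumes "k > 0" "[a = b] (mod int k)"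
  shows "root_char k (h * a) m = root_char k (h * b) m"
  unfolding root_char_def by (rule e_fun_cong[OF assms(1)]) (intro cong_scalar_left cong_scalar_right assms(2) | simp add: assms cong_mult)+

text \<open>The factor e(h d m/k) depends on d only modulo k. Fixing the class a of d decouples d
  from m, and for each a what remains is the convolution of two absolutely convergent
  series.\<close>

lemma estermann_series_eq:
  assumes k: "k > 0" and per: "\<And>a b. [a = b] (mod int k) \<Longrightarrow> \<psi> a = \<psi> b"
    and s: "1 < Re s" "1 < Re (s - \<xi>)"
  shows "estermann_series \<psi> \<xi> h k s =
    (\<Sum>a<k. \<psi> (int a) * (dirichlet_series (residue_ind k (int a)) (s - \<xi>) * dirichlet_series (root_char k (h * int a)) s))"
proof -
  define u where "u = (\<lambda>a i. residue_ind k (int a) (int (Suc i)) * of_nat (Suc i) powr (-(s - \<xi>)))"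
  define v where "v = (\<lambda>a j. root_char k (h * int a) (int (Suc j)) * of_nat (Suc j) powr (-s))"
  have su: "summable (\<lambda>i. norm (u a i))" for a
    unfolding u_def by (rule dirichlet_series_summable[OF norm_residue_ind s(2)])
  have sv: "summable (\<lambda>j. norm (v a j))" for a
    unfolding v_def by (rule dirichlet_series_summable[OF eq_refl[OF norm_root_char] s(1)])
  have "(\<lambda>n. \<Sum>a<k. \<psi> (int a) * (\<Sum>(i, j) | Suc i * Suc j = Suc n. u a i * v a j)) sums
     (\<Sum>a<k. \<psi> (int a) * (suminf (u a) * suminf (v a)))"
    by (intro sums_sum sums_mult sums_dirichlet_convolution su sv)
  moreover have "(\<Sum>a<k. \<psi> (int a) * (\<Sum>(i, j) | Suc i * Suc j = Suc n. u a i * v a j)) =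
     sigma_tw \<psi> \<xi> (Suc n) * e_fun (of_int h * of_nat (Suc n) / of_nat k) * of_nat (Suc n) powr (-s)" for n
  proof -
    have "(\<Sum>a<k. \<psi> (int a) * (\<Sum>(i, j) | Suc i * Suc j = Suc n. u a i * v a j)) =
        (\<Sum>(i, j) | Suc i * Suc j = Suc n. \<Sum>a<k. \<psi> (int a) * (u a i * v a j))"
      unfolding sum_distrib_left by (subst sum.swap) (simp add: case_prod_unfold)
    \<comment> \<open>Only the class a of the divisor i + 1 survives, and by periodicity a may be
      replaced by the divisor itself.\<close>
    also have "\<dots> = (\<Sum>(i, j) | Suc i * Suc j = Suc n. \<psi> (int (Suc i)) * root_char k (h * int (Suc i)) (int (Suc j)) *
        (of_nat (Suc i) powr (-(s - \<xi>)) * of_nat (Suc j) powr (-s)))"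
    proof (intro sum.cong refl, clarify)
      fix i j
      have "(\<Sum>a<k. \<psi> (int a) * (u a i * v a j)) =
         (\<Sum>a<k. residue_ind k (int a) (int (Suc i)) * (\<psi> (int a) * root_char k (h * int a) (int (Suc j)) *
           (of_nat (Suc i) powr (-(s - \<xi>)) * of_nat (Suc j) powr (-s))))"
        by (simp only: u_def v_def mult_ac)
      also have "\<dots> = \<psi> (int (Suc i)) * root_char k (h * int (Suc i)) (int (Suc j)) *
        (of_nat (Suc i) powr (-(s - \<xi>)) * of_nat (Suc j) powr (-s))"
        by (rule sum_residue_ind[OF k]) (simp only: per root_char_cong[OF k])
      finally show "(\<Sum>a<k. \<psi> (int a) * (u a i * v a j)) = \<dots>" .
    qed
    also have "\<dots> = (\<Sum>d | d dvd Suc n. \<psi> (int d) * root_char k (h * int d) (int (Suc n div d)) *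
        (of_nat d powr (-(s - \<xi>)) * of_nat (Suc n div d) powr (-s)))"
      by (rule sum_divisor_pairs)
    also have "\<dots> = (\<Sum>d | d dvd Suc n. \<psi> (int d) * of_nat d powr \<xi> *
        (e_fun (of_int h * of_nat (Suc n) / of_nat k) * of_nat (Suc n) powr (-s)))"
    proof (intro sum.cong refl)
      fix d assume "d \<in> {d. d dvd Suc n}"
      then obtain m where m: "Suc n = d * m" by (auto elim: dvdE)
      hence dm: "d > 0" "m > 0" by (auto intro!: Nat.gr0I)
      have "root_char k (h * int d) (int (Suc n div d)) = e_fun (of_int h * of_nat (Suc n) / of_nat k)"
        unfolding root_char_def m using dm by (simp add: mult_ac)
      moreover have "complex_of_nat (Suc n) powr (-s) = of_nat d powr (-s) * of_nat m powr (-s)"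
        unfolding m using powr_of_real_mult[of "real d" "real m" "-s"] dm by simp
      moreover have "of_nat d powr (-(s - \<xi>)) = of_nat d powr \<xi> * (of_nat d powr (-s) :: complex)"
        by (simp flip: powr_add)
      moreover have "Suc n div d = m" using m dm by simp
      ultimately show "\<psi> (int d) * root_char k (h * int d) (int (Suc n div d)) *
        (of_nat d powr (-(s - \<xi>)) * of_nat (Suc n div d) powr (-s)) = \<psi> (int d) * of_nat d powr \<xi> *
        (e_fun (of_int h * of_nat (Suc n) / of_nat k) * of_nat (Suc n) powr (-s))"
        by (simp only: mult_ac)
    qed
    also have "\<dots> = sigma_tw \<psi> \<xi> (Suc n) * e_fun (of_int h * of_nat (Suc n) / of_nat k) * of_nat (Suc n) powr (-s)"
      unfolding sigma_tw_def sum_distrib_right by (simp only: mult_ac)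
    finally show ?thesis .
  qed
  ultimately show ?thesis
    unfolding estermann_series_def dirichlet_series_def u_def v_def by (simp add: sums_iff)
qed

section \<open>Residue classes: characters, permutations, Fourier inversion\<close>

lemma dirichlet_char_cong:
  assumes c: "dirichlet_char q \<psi>" and ab: "[a = b] (mod int q)"
  shows "\<psi> a = \<psi> b"
proof -
  have per: "\<psi> (x + int q) = \<psi> x" for x using c by (simp add: dirichlet_char_def)
  have nat: "\<psi> (x + int n * int q) = \<psi> x" for x n
  proof (induction n)
    case (Suc n)
    have "x + int (Suc n) * int q = (x + int n * int q) + int q" by (simp add: algebra_simps)
    thus ?case using Suc.IH per[of "x + int n * int q"] by (simp only:)
  qed simp
  have "\<psi> x = \<psi> y" if "x \<le> y" "[x = y] (mod int q)" for x y
  proof -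
    obtain m where m: "y = x + int q * m" using \<open>[x = y] (mod int q)\<close> by (metis cong_iff_lin)
    have "q > 0" using c by (simp add: dirichlet_char_def)
    hence "0 \<le> m" using that(1) m by (simp add: zero_le_mult_iff)
    thus ?thesis using nat[of x "nat m"] m by (simp add: mult.commute)
  qed
  thus ?thesis using ab by (metis linear cong_sym)
qed

text \<open>c is a unit modulo k with inverse d, so multiplication by c permutes the
  classes.\<close>

lemma sum_residues_mult:
  assumes k: "k > 0" and per: "\<And>a b. [a = b] (mod int k) \<Longrightarrow> G a = G b"
    and cd: "[c * d = 1] (mod int k)"
  shows "(\<Sum>a<k. G (int a)) = (\<Sum>b<k. G (c * int b))"
proof (rule sum.reindex_bij_witness[of _ "\<lambda>b. nat ((c * int b) mod int k)" "\<lambda>a. nat ((d * int a) mod int k)"])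
  have inv: "nat ((x * int (nat ((y * int a) mod int k))) mod int k) = a"
    if a: "a \<in> {..<k}" and xy: "[x * y = 1] (mod int k)" for x y a
  proof -
    have "int (nat ((y * int a) mod int k)) = (y * int a) mod int k" using k by simp
    moreover have "(x * ((y * int a) mod int k)) mod int k = (x * y * int a) mod int k"
      by (simp add: mod_mult_right_eq mult.assoc)
    moreover have "[x * y * int a = 1 * int a] (mod int k)" by (intro cong_mult xy) simp
    hence "(x * y * int a) mod int k = int a" using a by (simp add: cong_def)
    ultimately show ?thesis by simp
  qed
  have dc: "[d * c = 1] (mod int k)" using cd by (simp add: mult.commute)
  fix a assume a: "a \<in> {..<k}"
  show "nat ((c * int (nat ((d * int a) mod int k))) mod int k) = a" by (rule inv[OF a cd])
  show "nat ((d * int (nat ((c * int a) mod int k))) mod int k) = a" by (rule inv[OF a dc])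
  show "nat ((d * int a) mod int k) \<in> {..<k}" "nat ((c * int a) mod int k) \<in> {..<k}"
    using k by (auto simp: nat_less_iff)
  have "int (nat ((d * int a) mod int k)) = (d * int a) mod int k" using k by simp
  moreover have "[c * ((d * int a) mod int k) = c * d * int a] (mod int k)"
    by (simp add: cong_def mod_mult_right_eq mult.assoc)
  moreover have "[c * d * int a = 1 * int a] (mod int k)" by (intro cong_mult cd) simp
  ultimately show "G (c * int (nat ((d * int a) mod int k))) = G (int a)"
    by (intro per) (metis cong_trans mult_1)
qed

lemma residue_ind_commute: "residue_ind k a b = residue_ind k b a"
  by (simp add: residue_ind_def cong_sym_eq)

text \<open>Finite Fourier inversion: it turns the functional equation of the periodic zeta functions into
  the Hurwitz formula for the series over a residue class.\<close>

lemma residue_comb_inversion: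
  assumes k: "k > 0" and per: "\<And>a b. [a = b] (mod int k) \<Longrightarrow> F a = F b"
  shows "(\<Sum>j<k. root_char k a (int j) * residue_comb k F (int j) u) = F a u"
    and "(\<Sum>j<k. root_char k (-a) (int j) * residue_comb k F (- int j) u) = F a u"
proof -
  have inner: "(\<Sum>i<k. residue_ind k (int i) a * F (int i) u) = F a u"
    using sum_residue_ind[OF k, of "\<lambda>a. F a u" a] per by metis
  have "(\<Sum>j<k. root_char k a (int j) * residue_comb k F (int j) u) =
     (\<Sum>j<k. \<Sum>i<k. root_char k (- int i) (int j) * root_char k (int j) a * F (int i) u) / of_nat k"
    unfolding residue_comb_def times_divide_eq_right sum_divide_distrib [symmetric] sum_distrib_left
    by (simp add: root_char_def mult_ac)
  also have "(\<Sum>j<k. \<Sum>i<k. root_char k (- int i) (int j) * root_char k (int j) a * F (int i) u) =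
     (\<Sum>i<k. (\<Sum>j<k. root_char k (- int i) (int j) * root_char k (int j) a) * F (int i) u)"
    unfolding sum_distrib_right by (rule sum.swap)
  also have "\<dots> / of_nat k = F a u"
    unfolding root_char_orthogonality[OF k] mult.assoc sum_distrib_left [symmetric] inner using k by simp
  finally show "(\<Sum>j<k. root_char k a (int j) * residue_comb k F (int j) u) = F a u" .
  have "(\<Sum>j<k. root_char k (-a) (int j) * residue_comb k F (- int j) u) =
     (\<Sum>j<k. \<Sum>i<k. root_char k (- a) (int j) * root_char k (int j) (int i) * F (int i) u) / of_nat k"
    unfolding residue_comb_def times_divide_eq_right sum_divide_distrib [symmetric] sum_distrib_left
    by (simp add: mult_ac)
  also have "(\<Sum>j<k. \<Sum>i<k. root_char k (- a) (int j) * root_char k (int j) (int i) * F (int i) u) =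
     (\<Sum>i<k. (\<Sum>j<k. root_char k (- a) (int j) * root_char k (int j) (int i)) * F (int i) u)"
    unfolding sum_distrib_right by (rule sum.swap)
  also have "\<dots> / of_nat k = F a u"
    unfolding root_char_orthogonality[OF k] mult.assoc sum_distrib_left [symmetric]
      residue_ind_commute[of k a] inner using k by simp
  finally show "(\<Sum>j<k. root_char k (-a) (int j) * residue_comb k F (- int j) u) = F a u" .
qed

section \<open>Identity principle and uniqueness of the continuation\<close>

text \<open>Values at singularities are arbitrary, so the identity theorem is applied to
  \<open>remove_sings\<close> of the difference, which vanishes identically; the difference itself
  agrees with it off a sparse set.\<close>

lemma meromorphic_identity_cosparse:
  assumes "f meromorphic_on UNIV" "g meromorphic_on UNIV" "open U" "U \<noteq> {}"
    and eq: "\<And>z. z \<in> U \<Longrightarrow> f z = g z"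
  shows "\<forall>\<^sub>\<approx>z. f z = g z"
proof -
  define h where "h = (\<lambda>z. f z - g z)"
  have h: "h meromorphic_on UNIV" unfolding h_def using assms(1,2) by (intro meromorphic_intros)
  have ev: "\<forall>\<^sub>\<approx>z. remove_sings h z = h z" by (rule eventually_remove_sings_eq[OF h])
  obtain z0 where z0: "z0 \<in> U" using assms(4) by blast
  have "eventually (\<lambda>z. remove_sings h z = h z) (at z0)"
    using ev by (rule eventually_cosparse_imp_eventually_at) auto
  moreover have "eventually (\<lambda>z. z \<in> U) (at z0)"
    using assms(3) z0 by (intro eventually_at_in_open') auto
  ultimately have "eventually (\<lambda>z. remove_sings h z = 0) (at z0)"
    by eventually_elim (simp add: h_def eq)
  hence "frequently (\<lambda>z. remove_sings h z = 0) (at z0)"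
    by (intro eventually_frequently) auto
  hence "remove_sings h z = 0" for z
    by (rule frequently_eq_meromorphic_imp_constant[where A = UNIV])
       (use remove_sings_nicely_meromorphic[OF h] in auto)
  hence "h z = 0 \<longrightarrow> f z = g z" "remove_sings h z = h z \<longrightarrow> h z = 0" for z
    by (auto simp: h_def)
  with ev show ?thesis by (auto elim!: eventually_mono)
qed

lemma translated_Ints_sparse: "{s. s - \<xi> \<in> \<int>} sparse_in (UNIV :: complex set)"
proof -
  have "\<not> y islimpt {s. s - \<xi> \<in> \<int>}" for y
  proof (rule discrete_imp_not_islimpt[OF zero_less_one])
    fix a b :: complex assume "a \<in> {s. s - \<xi> \<in> \<int>}" "b \<in> {s. s - \<xi> \<in> \<int>}" and d: "dist b a < 1"
    hence "b - \<xi> \<in> \<int>" "a - \<xi> \<in> \<int>" by simp_all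
    from Ints_diff[OF this] have "(b - \<xi>) - (a - \<xi>) \<in> \<int>" .
    then obtain n where n: "b - a = of_int n" by (auto elim: Ints_cases)
    with d have "\<bar>n\<bar> < 1" by (simp add: dist_norm)
    thus "b = a" using n by simp
  qed
  thus ?thesis by (simp add: sparse_in_open)
qed

text \<open>The right-hand side of \<open>estermann_series_eq\<close> with both Dirichlet series
  replaced by their continuations: an explicit model for every continuation D.\<close>

definition estermann_cont :: "nat \<Rightarrow> (int \<Rightarrow> complex \<Rightarrow> complex) \<Rightarrow> (int \<Rightarrow> complex) \<Rightarrow> complex \<Rightarrow> int \<Rightarrow> complex \<Rightarrow> complex" where
  "estermann_cont k F \<psi> \<xi> h s = (\<Sum>a<k. \<psi> (int a) * (residue_comb k F (int a) (s - \<xi>) * F (h * int a) s))"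

text \<open>Both conclusions come from the identity principle. For the second it is applied to the
  reflected functions on the reflected half-plane, which avoids transporting a sparse set along s
  \<mapsto> 1 + \<xi> - s.\<close>

lemma is_estermann_cont_unique:
  assumes k: "k > 0" and per: "\<And>a b. [a = b] (mod int k) \<Longrightarrow> \<psi> a = \<psi> b"
    and mero: "\<And>c. F c meromorphic_on UNIV"
    and series: "\<And>c s. 1 < Re s \<Longrightarrow> F c s = dirichlet_series (root_char k c) s"
    and D: "is_estermann_cont \<psi> \<xi> h k D"
  shows "\<forall>\<^sub>\<approx>s. D s = estermann_cont k F \<psi> \<xi> h s"
    and "\<forall>\<^sub>\<approx>s. D (1 + \<xi> - s) = estermann_cont k F \<psi> \<xi> h (1 + \<xi> - s)"
proof -
  have comp: "(\<lambda>s. f (a + b * s)) meromorphic_on UNIV" if "f meromorphic_on UNIV" for f :: "complex \<Rightarrow> complex" and a b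
    by (rule meromorphic_on_compose[OF that]) (auto intro!: analytic_intros)
  have "(\<lambda>s. F c (s - \<xi>)) meromorphic_on UNIV" for c
    using comp[OF mero[of c], of "-\<xi>" 1] by simp
  hence E: "estermann_cont k F \<psi> \<xi> h meromorphic_on UNIV"
    unfolding estermann_cont_def [abs_def] residue_comb_def
    by (intro meromorphic_intros mero) auto
  from D obtain \<sigma> where D: "D meromorphic_on UNIV" "\<And>s. \<sigma> < Re s \<Longrightarrow> D s = estermann_series \<psi> \<xi> h k s"
    unfolding is_estermann_cont_def by blast
  \<comment> \<open>To the right of \<tau> the given series for D is valid and the Dirichlet series
    at s and at s - \<xi> both converge.\<close>
  define \<tau> where "\<tau> = max \<sigma> (max 1 (1 + Re \<xi>))"
  have eq: "D s = estermann_cont k F \<psi> \<xi> h s" if "\<tau> < Re s" for s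
  proof -
    have s: "\<sigma> < Re s" "1 < Re s" "1 < Re (s - \<xi>)" using that by (auto simp: \<tau>_def)
    have "residue_comb k F a (s - \<xi>) = dirichlet_series (residue_ind k a) (s - \<xi>)" for a
      unfolding residue_comb_def residue_ind_series_eq_sum[OF k s(3)] series[OF s(3)] ..
    thus ?thesis
      by (simp add: D(2) s estermann_series_eq[OF k per s(2,3)] estermann_cont_def series)
  qed
  have "of_real (\<tau> + 1) \<in> {s. \<tau> < Re s}" by simp
  hence ne: "{s. \<tau> < Re s} \<noteq> {}" by blast
  show "\<forall>\<^sub>\<approx>s. D s = estermann_cont k F \<psi> \<xi> h s"
    by (rule meromorphic_identity_cosparse[OF D(1) E open_halfspace_Re_gt ne]) (simp add: eq)
  have m: "(\<lambda>s. D (1 + \<xi> - s)) meromorphic_on UNIV" "(\<lambda>s. estermann_cont k F \<psi> \<xi> h (1 + \<xi> - s)) meromorphic_on UNIV"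
    using comp[OF D(1), of "1 + \<xi>" "-1"] comp[OF E, of "1 + \<xi>" "-1"] by simp_all
  have "of_real (1 + Re \<xi> - \<tau> - 1) \<in> {s. Re s < 1 + Re \<xi> - \<tau>}" by simp
  hence ne': "{s. Re s < 1 + Re \<xi> - \<tau>} \<noteq> {}" by blast
  show "\<forall>\<^sub>\<approx>s. D (1 + \<xi> - s) = estermann_cont k F \<psi> \<xi> h (1 + \<xi> - s)"
    by (rule meromorphic_identity_cosparse[OF m open_halfspace_Re_lt ne']) (simp add: eq)
qed

section \<open>Functional equation of the Estermann function\<close>

text \<open>With w = 1 + \<xi> - s one has 1 - (s - \<xi>) = w and 1 - s = w - \<xi>. The two
  functional equations thus exchange roles: the residue series at s - \<xi> becomes periodic zeta
  functions at w, the periodic zeta function at s becomes residue series at w - \<xi>, and the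
  product again has the shape of an Estermann sum at w.\<close>

lemma estermann_cont_functional_equation:
  assumes k: "k > 0"
    and hol: "\<And>c. F c holomorphic_on - \<int>"
    and series: "\<And>c s. 1 < Re s \<Longrightarrow> F c s = dirichlet_series (root_char k c) s"
    and dual: "\<And>c s. Re s < 0 \<Longrightarrow> F c s = periodic_zeta_dual k c s"
    and F_per: "\<And>a b. [a = b] (mod int k) \<Longrightarrow> F a = F b"
    and mult: "\<And>a b. \<psi> (a * b) = \<psi> a * \<psi> b"
    and \<psi>_per: "\<And>a b. [a = b] (mod int k) \<Longrightarrow> \<psi> a = \<psi> b"
    and h: "[h * hb = 1] (mod int k)"
    and s: "s \<notin> \<int>" "s - \<xi> \<notin> \<int>"
  shows "estermann_cont k F \<psi> \<xi> h s =
    \<psi> (- hb) * (of_real (2 * pi)) powr (2 * s - \<xi> - 2) * (of_nat k) powr (\<xi> - 2 * s + 1)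
    * Gamma (1 - s) * Gamma (1 + \<xi> - s)
    * ((e_fun (\<xi> / 4) + \<psi> (-1) * e_fun (- \<xi> / 4)) * estermann_cont k F \<psi> \<xi> hb (1 + \<xi> - s)
       - (e_fun ((2 * s - \<xi>) / 4) + \<psi> (-1) * e_fun (- (2 * s - \<xi>) / 4)) * estermann_cont k F \<psi> \<xi> (- hb) (1 + \<xi> - s))"
proof -
  define L where "L = residue_comb k F"
  define w where "w = 1 + \<xi> - s"
  define G where "G = (\<lambda>s :: complex. Gamma (1 - s) * of_real (2 * pi) powr (s - 1) * of_nat k powr (1 - s))"
  define X where "X = (\<lambda>s :: complex. exp (- (\<i> * of_real pi * (s - 1) / 2)))"
  define Y where "Y = (\<lambda>s :: complex. exp (\<i> * of_real pi * (s - 1) / 2))"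
  have fe: "F c z = G z * (X z * L c (1 - z) + Y z * L (-c) (1 - z))" if "z \<notin> \<int>" for c z
    unfolding G_def X_def Y_def L_def
    by (rule periodic_zeta_functional_equation[OF k hol series dual that])
  have L_per: "L a = L b" if "[a = b] (mod int k)" for a b
  proof -
    have "root_char k (-a) n = root_char k (-b) n" for n
      unfolding root_char_def
      by (rule e_fun_cong[OF k], rule cong_mult) (use that in \<open>simp_all add: cong_minus_minus_iff\<close>)
    thus ?thesis by (simp add: L_def residue_comb_def [abs_def])
  qed
  have fe_L: "L a (s - \<xi>) = G (s - \<xi>) / of_nat k * (X (s - \<xi>) * F (-a) w + Y (s - \<xi>) * F a w)" for a
  proof -
    have w: "1 - (s - \<xi>) = w" by (simp add: w_def)
    have "L a (s - \<xi>) = (\<Sum>j<k. root_char k (-a) (int j) *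
        (G (s - \<xi>) * (X (s - \<xi>) * L (int j) w + Y (s - \<xi>) * L (- int j) w))) / of_nat k"
      by (subst L_def, subst residue_comb_def) (simp only: fe[OF s(2)] w)
    also have "(\<Sum>j<k. root_char k (-a) (int j) *
        (G (s - \<xi>) * (X (s - \<xi>) * L (int j) w + Y (s - \<xi>) * L (- int j) w))) =
      G (s - \<xi>) * (X (s - \<xi>) * (\<Sum>j<k. root_char k (-a) (int j) * L (int j) w) +
        Y (s - \<xi>) * (\<Sum>j<k. root_char k (-a) (int j) * L (- int j) w))"
      unfolding sum_distrib_left sum.distrib [symmetric] by (rule sum.cong) (simp_all add: algebra_simps)
    also have "(\<Sum>j<k. root_char k (-a) (int j) * L (int j) w) = F (-a) w"
      unfolding L_def by (rule residue_comb_inversion(1)[OF k F_per])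
    also have "(\<Sum>j<k. root_char k (-a) (int j) * L (- int j) w) = F a w"
      unfolding L_def by (rule residue_comb_inversion(2)[OF k F_per])
    finally show ?thesis by simp
  qed
  define E where "E = (\<lambda>c. \<Sum>a<k. \<psi> (int a) * (L (int a) (w - \<xi>) * F (c * int a) w))"
  have sw: "1 - s = w - \<xi>" by (simp add: w_def)
  \<comment> \<open>\<epsilon> is the sign in the periodic zeta function, \<delta> the sign in the
    residue series. Substituting a = \<delta> hb b frees the residue series of h and leaves
    \<epsilon>\<delta> hb in the other factor: equal signs lead to hb, opposite signs to
    -hb.\<close>
  have reindex: "(\<Sum>a<k. \<psi> (int a) * F (\<epsilon> * int a) w * L (\<delta> * h * int a) (w - \<xi>)) = \<psi> (\<delta> * hb) * E (\<epsilon> * \<delta> * hb)"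
    if \<delta>: "\<delta> * \<delta> = 1" for \<epsilon> \<delta>
  proof -
    have cd: "[(\<delta> * hb) * (\<delta> * h) = 1] (mod int k)"
    proof -
      have "(\<delta> * hb) * (\<delta> * h) = (\<delta> * \<delta>) * (h * hb)" by (simp only: mult_ac)
      also have "\<dots> = h * hb" unfolding \<delta> by simp
      finally show ?thesis using h by (simp only:)
    qed
    have "(\<Sum>a<k. \<psi> (int a) * F (\<epsilon> * int a) w * L (\<delta> * h * int a) (w - \<xi>)) =
       (\<Sum>b<k. \<psi> (\<delta> * hb * int b) * F (\<epsilon> * (\<delta> * hb * int b)) w * L (\<delta> * h * (\<delta> * hb * int b)) (w - \<xi>))"
    proof (rule sum_residues_mult[OF k _ cd])
      fix a b assume ab: "[a = b] (mod int k)"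
      have "F (\<epsilon> * a) = F (\<epsilon> * b)" by (rule F_per, rule cong_mult) (use ab in simp_all)
      moreover have "L (\<delta> * h * a) = L (\<delta> * h * b)" by (rule L_per, rule cong_mult) (use ab in simp_all)
      ultimately show "\<psi> a * F (\<epsilon> * a) w * L (\<delta> * h * a) (w - \<xi>) = \<psi> b * F (\<epsilon> * b) w * L (\<delta> * h * b) (w - \<xi>)"
        using \<psi>_per[OF ab] by simp
    qed
    also have "\<dots> = (\<Sum>b<k. \<psi> (\<delta> * hb) * (\<psi> (int b) * (L (int b) (w - \<xi>) * F (\<epsilon> * \<delta> * hb * int b) w)))"
    proof (rule sum.cong)
      fix b
      have "[\<delta> * h * (\<delta> * hb * int b) = 1 * int b] (mod int k)"
      proof -
        have "\<delta> * h * (\<delta> * hb * int b) = (\<delta> * hb) * (\<delta> * h) * int b" by (simp only: mult_ac)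
        thus ?thesis by (simp only:) (rule cong_mult[OF cd cong_refl])
      qed
      hence l: "L (\<delta> * h * (\<delta> * hb * int b)) = L (int b)" using L_per by simp
      have e: "\<epsilon> * (\<delta> * hb * int b) = \<epsilon> * \<delta> * hb * int b" by (simp only: mult_ac)
      show "\<psi> (\<delta> * hb * int b) * F (\<epsilon> * (\<delta> * hb * int b)) w * L (\<delta> * h * (\<delta> * hb * int b)) (w - \<xi>) =
         \<psi> (\<delta> * hb) * (\<psi> (int b) * (L (int b) (w - \<xi>) * F (\<epsilon> * \<delta> * hb * int b) w))"
        unfolding l e mult[of "\<delta> * hb" "int b"] by (simp only: mult_ac)
    qed simp
    also have "\<dots> = \<psi> (\<delta> * hb) * E (\<epsilon> * \<delta> * hb)"
      unfolding E_def sum_distrib_left ..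
    finally show ?thesis .
  qed
  define T where "T = (\<lambda>\<epsilon> \<delta>. \<Sum>a<k. \<psi> (int a) * F (\<epsilon> * int a) w * L (\<delta> * h * int a) (w - \<xi>))"
  have T: "T 1 1 = \<psi> hb * E hb" "T (-1) 1 = \<psi> hb * E (- hb)"
    "T 1 (-1) = \<psi> (- hb) * E (- hb)" "T (-1) (-1) = \<psi> (- hb) * E hb"
    using reindex[of 1 1] reindex[of 1 "-1"] reindex[of "-1" 1] reindex[of "-1" "-1"] by (simp_all add: T_def)
  \<comment> \<open>Two of the four terms carry \<psi>(hb) and two carry \<psi>(-hb); factoring out
    the latter is what introduces \<psi>(-1).\<close>
  have \<psi>hb: "\<psi> hb = \<psi> (-1) * \<psi> (- hb)" using mult[of "-1" "-hb"] by simp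
  let ?t = "s - \<xi>"
  have "estermann_cont k F \<psi> \<xi> h s =
     (\<Sum>a<k. \<psi> (int a) * ((G ?t / of_nat k * (X ?t * F (- int a) w + Y ?t * F (int a) w)) *
        (G s * (X s * L (h * int a) (w - \<xi>) + Y s * L (- (h * int a)) (w - \<xi>)))))"
    unfolding estermann_cont_def L_def [symmetric] fe_L fe[OF s(1)] sw ..
  also have "\<dots> = (\<Sum>a<k. G ?t * G s / of_nat k *
      (X ?t * X s * (\<psi> (int a) * F (- 1 * int a) w * L (1 * h * int a) (w - \<xi>)) +
       X ?t * Y s * (\<psi> (int a) * F (- 1 * int a) w * L (- 1 * h * int a) (w - \<xi>)) +
       Y ?t * X s * (\<psi> (int a) * F (1 * int a) w * L (1 * h * int a) (w - \<xi>)) +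
       Y ?t * Y s * (\<psi> (int a) * F (1 * int a) w * L (- 1 * h * int a) (w - \<xi>))))"
    by (rule sum.cong) (simp_all add: field_simps)
  also have "\<dots> = G ?t * G s / of_nat k * (X ?t * X s * T (-1) 1 + X ?t * Y s * T (-1) (-1) +
       Y ?t * X s * T 1 1 + Y ?t * Y s * T 1 (-1))"
    unfolding T_def sum_distrib_left sum.distrib [symmetric] ..
  also have "\<dots> = G ?t * G s / of_nat k * \<psi> (- hb) * ((X ?t * Y s + \<psi> (-1) * (Y ?t * X s)) * E hb +
       (Y ?t * Y s + \<psi> (-1) * (X ?t * X s)) * E (- hb))"
    unfolding T \<psi>hb by (simp add: algebra_simps)
  \<comment> \<open>The exponents -pi i (s - \<xi> - 1)/2 and pi i (s - 1)/2 add up to pi i \<xi>/2,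
    so s cancels; in units of 2 pi i this is \<xi>/4.\<close>
  also have "X ?t * Y s = e_fun (\<xi> / 4)"
    unfolding X_def Y_def e_fun_def exp_add [symmetric]
    by (rule arg_cong[of _ _ exp]) (simp add: algebra_simps add_divide_distrib diff_divide_distrib)
  also have "Y ?t * X s = e_fun (- \<xi> / 4)"
    unfolding X_def Y_def e_fun_def exp_add [symmetric]
    by (rule arg_cong[of _ _ exp]) (simp add: algebra_simps add_divide_distrib diff_divide_distrib)
  \<comment> \<open>Here the exponents add up to pi i (2s - \<xi>)/2 - pi i; the excess -pi i is the
    origin of the minus sign in front of the second bracket.\<close>
  also have "Y ?t * Y s = - e_fun ((2 * s - \<xi>) / 4)"
  proof -
    have "Y ?t * Y s = exp (2 * of_real pi * \<i> * ((2 * s - \<xi>) / 4) + - (of_real pi * \<i>))"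
      unfolding Y_def exp_add [symmetric]
      by (rule arg_cong[of _ _ exp]) (simp add: algebra_simps add_divide_distrib diff_divide_distrib)
    also have "\<dots> = e_fun ((2 * s - \<xi>) / 4) * exp (- (of_real pi * \<i>))"
      unfolding e_fun_def by (rule exp_add)
    also have "exp (- (of_real pi * \<i>)) = - 1" by (simp add: exp_minus)
    finally show ?thesis by simp
  qed
  also have "X ?t * X s = - e_fun (- (2 * s - \<xi>) / 4)"
  proof -
    have "X ?t * X s = exp (2 * of_real pi * \<i> * (- (2 * s - \<xi>) / 4) + of_real pi * \<i>)"
      unfolding X_def exp_add [symmetric]
      by (rule arg_cong[of _ _ exp]) (simp add: algebra_simps add_divide_distrib diff_divide_distrib)
    also have "\<dots> = e_fun (- (2 * s - \<xi>) / 4) * exp (of_real pi * \<i>)"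
      unfolding e_fun_def by (rule exp_add)
    finally show ?thesis by simp
  qed
  also have "G ?t * G s / of_nat k = of_real (2 * pi) powr (2 * s - \<xi> - 2) * of_nat k powr (\<xi> - 2 * s + 1)
      * Gamma (1 - s) * Gamma (1 + \<xi> - s)"
  proof -
    have "of_real (2 * pi) powr (?t - 1) * of_real (2 * pi) powr (s - 1) = (of_real (2 * pi) powr (2 * s - \<xi> - 2) :: complex)"
      unfolding powr_add [symmetric] by (rule arg_cong[of _ _ "\<lambda>z. _ powr z"]) simp
    \<comment> \<open>The two powers of k have total exponent \<xi> - 2s + 2; the 1/k from Fourier
      inversion lowers it to \<xi> - 2s + 1.\<close>
    moreover have "of_nat k powr (1 - ?t) * of_nat k powr (1 - s) / of_nat k = (of_nat k powr (\<xi> - 2 * s + 1) :: complex)"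
    proof -
      have "of_nat k powr (1 - ?t) * of_nat k powr (1 - s) = (of_nat k powr ((\<xi> - 2 * s + 1) + 1) :: complex)"
        unfolding powr_add [symmetric] by (rule arg_cong[of _ _ "\<lambda>z. _ powr z"]) simp
      also have "\<dots> = of_nat k powr (\<xi> - 2 * s + 1) * of_nat k"
        by (subst powr_add) simp
      finally have e: "of_nat k powr (1 - ?t) * of_nat k powr (1 - s) = (of_nat k powr (\<xi> - 2 * s + 1) * of_nat k :: complex)" .
      show ?thesis unfolding e by (rule nonzero_mult_div_cancel_right) (use k in simp)
    qed
    moreover have "1 - ?t = 1 + \<xi> - s" by simp
    moreover have "G ?t * G s / of_nat k = (of_real (2 * pi) powr (?t - 1) * of_real (2 * pi) powr (s - 1)) *
       (of_nat k powr (1 - ?t) * of_nat k powr (1 - s) / of_nat k) * Gamma (1 - s) * Gamma (1 - ?t)"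
      unfolding G_def by (simp only: mult_ac times_divide_eq_right times_divide_eq_left)
    ultimately show ?thesis by (simp only:)
  qed
  finally have main: "estermann_cont k F \<psi> \<xi> h s = of_real (2 * pi) powr (2 * s - \<xi> - 2) *
      of_nat k powr (\<xi> - 2 * s + 1) * Gamma (1 - s) * Gamma (1 + \<xi> - s) * \<psi> (- hb) *
      ((e_fun (\<xi> / 4) + \<psi> (- 1) * e_fun (- \<xi> / 4)) * E hb +
       (- e_fun ((2 * s - \<xi>) / 4) + \<psi> (- 1) * - e_fun (- (2 * s - \<xi>) / 4)) * E (- hb))" .
  have alg: "P * K * G1 * G2 * z * ((e1 + p * e2) * A + (- e3 + p * - e4) * B) =
      z * P * K * G1 * G2 * ((e1 + p * e2) * A - (e3 + p * e4) * B)"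
    for P K G1 G2 z e1 e2 e3 e4 p A B :: complex
    by (simp add: algebra_simps)
  have E: "estermann_cont k F \<psi> \<xi> c (1 + \<xi> - s) = E c" for c
    by (simp only: estermann_cont_def E_def L_def w_def)
  show ?thesis unfolding E by (rule trans[OF main alg])
qed

theorem theorem2p1:
  fixes q l :: nat and \<psi> :: "int \<Rightarrow> complex" and h hb :: int and \<xi> :: complex
    and D1 D2 D3 :: "complex \<Rightarrow> complex"
  assumes "q > 0" and "l > 0"
    and "primitive_dirichlet_char q \<psi>"
    and "coprime h (int (l * q))"
    and "[h * hb = 1] (mod int (l * q))"
    and "is_estermann_cont \<psi> \<xi> h (l * q) D1"
    and "is_estermann_cont \<psi> \<xi> hb (l * q) D2"
    and "is_estermann_cont \<psi> \<xi> (- hb) (l * q) D3"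
  shows "\<forall>\<^sub>\<approx>s. D1 s =
    \<psi> (- hb) * (of_real (2 * pi)) powr (2 * s - \<xi> - 2) * (of_nat (l * q)) powr (\<xi> - 2 * s + 1)
    * Gamma (1 - s) * Gamma (1 + \<xi> - s)
    * ((e_fun (\<xi> / 4) + \<psi> (-1) * e_fun (- \<xi> / 4)) * D2 (1 + \<xi> - s)
       - (e_fun ((2 * s - \<xi>) / 4) + \<psi> (-1) * e_fun (- (2 * s - \<xi>) / 4)) * D3 (1 + \<xi> - s))"
proof -
  have k: "l * q > 0" using assms(1,2) by simp
  have char: "dirichlet_char q \<psi>" using assms(3) by (simp add: primitive_dirichlet_char_def)
  have mult: "\<psi> (a * b) = \<psi> a * \<psi> b" for a b using char by (simp add: dirichlet_char_def)
  have per: "\<psi> a = \<psi> b" if "[a = b] (mod int (l * q))" for a b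
  proof (rule dirichlet_char_cong[OF char])
    show "[a = b] (mod int q)" by (rule cong_dvd_modulus[OF that]) simp
  qed
  obtain F where F: "\<And>c. F c holomorphic_on - \<int>" "\<And>c. F c meromorphic_on UNIV"
    "\<And>c s. 1 < Re s \<Longrightarrow> F c s = dirichlet_series (root_char (l * q) c) s"
    "\<And>c s. Re s < 0 \<Longrightarrow> F c s = periodic_zeta_dual (l * q) c s"
    "\<And>a b. [a = b] (mod int (l * q)) \<Longrightarrow> F a = F b"
    by (rule periodic_zeta_continuation[OF k]) (rule that)
  have unique: "\<forall>\<^sub>\<approx>s. D s = estermann_cont (l * q) F \<psi> \<xi> c s"
    "\<forall>\<^sub>\<approx>s. D (1 + \<xi> - s) = estermann_cont (l * q) F \<psi> \<xi> c (1 + \<xi> - s)"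
    if "is_estermann_cont \<psi> \<xi> c (l * q) D" for c D
    by (rule is_estermann_cont_unique[OF k per F(2) F(3) that]; assumption)+
  \<comment> \<open>Besides the sparse sets where D1, D2, D3 deviate from the explicit sums, the
    integers and their translate by \<xi> are avoided: there the Gamma factors or the periodic zeta
    functions may be singular.\<close>
  have ni: "\<forall>\<^sub>\<approx>s. s - c \<notin> \<int>" for c :: complex
    using translated_Ints_sparse[of c] by (simp add: eventually_cosparse)
  show ?thesis
    using unique(1)[OF assms(6)] unique(2)[OF assms(7)] unique(2)[OF assms(8)] ni[of 0] ni[of \<xi>]
  proof eventually_elim
    case (elim s)
    have "s \<notin> \<int>" using elim(4) by simp
    show ?case unfolding elim(1-3)
      by (rule estermann_cont_functional_equation[OF k F(1) F(3) F(4) F(5) mult per assms(5) \<open>s \<notin> \<int>\<close> elim(5)])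
  qed
qed

end
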